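(* Let $X,Y$ be complex Banach spaces and let $(T,\Sigma_T,\mu)$, $(S,\Sigma_S,\nu)$ be positive measure spaces. Let $Z$ be a subspace of $Y^*$ that $\tau$-norms $Y$ ($\tau\ge 1$). Let $\theta\in[1,\infty)$, $\frac1q-\frac1p=1-\frac1\theta$ and $1\le q<\frac{\theta}{\theta-1}\le\infty$. Let $k:T\times S\to B(X,Y)$ satisfy the following conditions, with constants $C_1,C_2$. (A) For every $A\in\Sigma_S^{\mathrm{finite}}$ and every $x\in X$: (a) there is $T_{A,x}\in\Sigma_T^{\mathrm{full}}$ such that for all $t\in T_{A,x}$ the Bochner integral $\int_A k(t,s)x\,d\nu(s)$ exists; and (b) $t\mapsto\int_A k(t,s)x\,d\nu(s)$ defines a measurable function from $T$ into $Y$. (B) For every $x\in X$: (a) the real-valued map $(t,s)\mapsto\|k(t,s)x\|_Y^{\theta}$ is product measurable; and (b) there is $S_x\in\Sigma_S^{\mathrm{full}}$ such that $\left(\int_T\|k(t,s)x\|_Y^\theta\,d\mu(t)\right)^{1/\theta}\le C_1\|x\|_X$ for all $s\in S_x$. (C) For every $y^*\in Z$ there is $T_{y^*}\in\Sigma_T^{\mathrm{full}}$ such that for all $t\in T_{y^*}$: (a) the real-valued map $s\mapsto\|k^*(t,s)y^*\|_{X^*}^{\theta}$ is measurable; and (b) $\left(\int_S\|k^*(t,s)y^*\|_{X^*}^\theta\,d\nu(s)\right)^{1/\theta}\le C_2\|y^*\|_{Y^*}$. Then the integral operator $$(Kf)(t)=\int_S k(t,s)f(s)\,d\nu(s),\qquad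 f\in\mathcal{E}(S,X),$$ extends to a bounded linear operator $K:L_q(S,X)\to L_p(T,Y)$ with $$\|K\|_{L_q\to L_p}\le (C_1)^{\theta/p}\,(\tau C_2)^{1-\theta/p}.$$
   Context: $B(X,Y)$ is the space of bounded linear operators from $X$ to $Y$; $k^*(t,s)=k(t,s)^*\in B(Y^*,X^* )$ is the adjoint. $\frac{\theta}{\theta-1}$ means $\infty$ when $\theta=1$. $\Sigma_S^{\mathrm{finite}}=\{A\in\Sigma_S:\nu(A)<\infty\}$; $\Sigma_S^{\mathrm{full}}=\{A\in\Sigma_S:\nu(S\setminus A)=0\}$, and similarly for $T$. $\mathcal{E}(S,X)=\{\sum_{i=1}^n x_i1_{A_i}: x_i\in X,\ A_i\in\Sigma_S^{\mathrm{finite}},\ n\in\mathbb{N}\}$ is the space of finitely-valued, finitely supported measurable functions. A function $f:S\to X$ is measurable if some sequence in $\mathcal{E}(S,X)$ converges to $f$ (in the norm of $X$, pointwise almost everywhere); similarly for $T\to Y$. $L_p$ spaces of vector-valued functions are Bochner spaces. A subspace $Z\subset Y^*$ $\tau$-norms $Y$ if $\|y\|_Y\le\tau\sup\{|y^*(y)|: y^*\in Z,\ \|y^*\|\le1\}$ for all $y\in Y$. Under condition (A), for each $f\in\mathcal{E}(S,X)$ the Bochner integral defining $(Kf)(t)$ exists for $t$ in a set in $\Sigma_T^{\mathrm{full}}$ and $Kf$ is a measurable function. *)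

theory Defs
  imports "HOL-Analysis.Analysis"
begin

section \<open>Complex Banach spaces\<close>

class complex_normed_vector = real_normed_vector +
  fixes scaleC :: "complex \<Rightarrow> 'a \<Rightarrow> 'a"  (infixr \<open>*\<^sub>C\<close> 75)
  assumes scaleC_add_right: "a *\<^sub>C (x + y) = a *\<^sub>C x + a *\<^sub>C y"
    and scaleC_add_left: "(a + b) *\<^sub>C x = a *\<^sub>C x + b *\<^sub>C x"
    and scaleC_scaleC: "a *\<^sub>C (b *\<^sub>C x) = (a * b) *\<^sub>C x"
    and scaleC_of_real: "complex_of_real r *\<^sub>C x = r *\<^sub>R x"
    and norm_scaleC: "norm (a *\<^sub>C x) = cmod a * norm x"

class complex_banach = complex_normed_vector + banach

instantiation complex :: complex_banach
begin

definition scaleC_complex :: "complex \<Rightarrow> complex \<Rightarrow> complex" where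
  "scaleC_complex a x = a * x"

instance
  by standard (simp_all add: scaleC_complex_def algebra_simps norm_mult scaleR_conv_of_real)

end

lemma bounded_linear_scaleC: "bounded_linear (\<lambda>x :: 'a :: complex_normed_vector. a *\<^sub>C x)"
proof (rule bounded_linear_intro[where K = "cmod a"])
  fix r :: real and x :: 'a
  show "a *\<^sub>C (r *\<^sub>R x) = r *\<^sub>R (a *\<^sub>C x)"
    by (simp add: scaleC_of_real[symmetric] scaleC_scaleC mult.commute)
qed (simp_all add: scaleC_add_right norm_scaleC mult.commute)

instantiation blinfun :: (real_normed_vector, complex_normed_vector) complex_normed_vector
begin

lift_definition scaleC_blinfun :: "complex \<Rightarrow> ('a \<Rightarrow>\<^sub>L 'b) \<Rightarrow> ('a \<Rightarrow>\<^sub>L 'b)"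
  is "\<lambda>a f x. a *\<^sub>C f x"
  by (rule bounded_linear_compose[OF bounded_linear_scaleC])

instance
proof
  fix a b :: complex and r :: real and f g :: "'a \<Rightarrow>\<^sub>L 'b"
  show "a *\<^sub>C (f + g) = a *\<^sub>C f + a *\<^sub>C g"
    by transfer (simp add: scaleC_add_right)
  show "(a + b) *\<^sub>C f = a *\<^sub>C f + b *\<^sub>C f"
    by transfer (simp add: scaleC_add_left)
  show "a *\<^sub>C (b *\<^sub>C f) = (a * b) *\<^sub>C f"
    by transfer (simp add: scaleC_scaleC)
  show "complex_of_real r *\<^sub>C f = r *\<^sub>R f"
    by transfer (simp add: scaleC_of_real)
  have le: "norm (c *\<^sub>C h) \<le> cmod c * norm h" for c and h :: "'a \<Rightarrow>\<^sub>L 'b"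
  proof (rule norm_blinfun_bound)
    fix x
    have "norm (blinfun_apply (c *\<^sub>C h) x) = cmod c * norm (blinfun_apply h x)"
      by (simp add: scaleC_blinfun.rep_eq norm_scaleC)
    also have "\<dots> \<le> cmod c * (norm h * norm x)"
      by (intro mult_left_mono norm_blinfun) simp
    finally show "norm (blinfun_apply (c *\<^sub>C h) x) \<le> cmod c * norm h * norm x"
      by (simp add: mult.assoc)
  qed simp
  show "norm (a *\<^sub>C f) = cmod a * norm f"
  proof (cases "a = 0")
    case True
    then show ?thesis using le[of 0 f] by simp
  next
    case False
    have "inverse a *\<^sub>C (a *\<^sub>C f) = f"
      using False scaleC_of_real[of 1]
      by (intro blinfun_eqI) (simp add: scaleC_blinfun.rep_eq scaleC_scaleC)
    with le[of "inverse a" "a *\<^sub>C f"] have "norm f \<le> inverse (cmod a) * norm (a *\<^sub>C f)"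
      by (simp add: norm_inverse)
    with False have "cmod a * norm f \<le> norm (a *\<^sub>C f)"
      by (simp add: field_simps)
    with le[of a f] show ?thesis by simp
  qed
qed

end

text \<open>
  The type \<open>'x \<Rightarrow>\<^sub>L 'y\<close> only enforces real linearity. The space \<open>B(X,Y)\<close> is the following
  subset, with the operator norm inherited from the type.
\<close>

definition bounded_clinear_ops ::
    "('x :: complex_normed_vector \<Rightarrow>\<^sub>L 'y :: complex_normed_vector) set" where
  "bounded_clinear_ops = {f. \<forall>a x. blinfun_apply f (a *\<^sub>C x) = a *\<^sub>C blinfun_apply f x}"

definition cdual :: "('y :: complex_normed_vector \<Rightarrow>\<^sub>L complex) set" where
  "cdual = bounded_clinear_ops"

definition csubspace :: "'a :: complex_normed_vector set \<Rightarrow> bool" where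
  "csubspace V \<longleftrightarrow> 0 \<in> V \<and> (\<forall>u\<in>V. \<forall>v\<in>V. u + v \<in> V) \<and> (\<forall>a. \<forall>v\<in>V. a *\<^sub>C v \<in> V)"

definition dual_adjoint ::
    "('x :: complex_normed_vector \<Rightarrow>\<^sub>L 'y :: complex_normed_vector)
      \<Rightarrow> ('y \<Rightarrow>\<^sub>L complex) \<Rightarrow> ('x \<Rightarrow>\<^sub>L complex)" where
  "dual_adjoint u y' = y' o\<^sub>L u"

definition norms_space ::
    "real \<Rightarrow> ('y :: complex_normed_vector \<Rightarrow>\<^sub>L complex) set \<Rightarrow> bool" where
  "norms_space \<tau> Z \<longleftrightarrow>
     (\<forall>y. norm y \<le> \<tau> * (SUP y'\<in>{y'\<in>Z. norm y' \<le> 1}. cmod (blinfun_apply y' y)))"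

section \<open>Measurability and the Bochner integral\<close>

text \<open>
  The library's \<^const>\<open>integrable\<close> and \<^const>\<open>lebesgue_integral\<close> require a second countable range
  type, which would restrict the theory to separable Banach spaces, and they ask for Borel
  measurability on the nose rather than up to null sets. Hence the notions below, which work in
  arbitrary Banach spaces.
\<close>

definition finite_sets :: "'a measure \<Rightarrow> 'a set set" where
  "finite_sets M = {A \<in> sets M. emeasure M A < \<infinity>}"

definition full_sets :: "'a measure \<Rightarrow> 'a set set" where
  "full_sets M = {A \<in> sets M. emeasure M (space M - A) = 0}"

definition simple_funs :: "'a measure \<Rightarrow> ('a \<Rightarrow> 'b :: real_normed_vector) set" where
  "simple_funs M = {f. \<exists>(n :: nat) x A. (\<forall>i<n. A i \<in> finite_sets M) \<and>
     f = (\<lambda>s. \<Sum>i<n. indicator (A i) s *\<^sub>R x i)}"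

definition strongly_measurable :: "'a measure \<Rightarrow> ('a \<Rightarrow> 'b :: real_normed_vector) \<Rightarrow> bool" where
  "strongly_measurable M f \<longleftrightarrow>
     (\<exists>\<phi>. (\<forall>n. \<phi> n \<in> simple_funs M) \<and> (AE s in M. (\<lambda>n. \<phi> n s) \<longlonglongrightarrow> f s))"

definition has_vector_bochner_integral ::
    "'a measure \<Rightarrow> ('a \<Rightarrow> 'b :: real_normed_vector) \<Rightarrow> 'b \<Rightarrow> bool" where
  "has_vector_bochner_integral M f I \<longleftrightarrow> strongly_measurable M f \<and>
     (\<exists>\<phi>. (\<forall>n. \<phi> n \<in> simple_funs M) \<and>
          (\<lambda>n. \<integral>\<^sup>+ s. ennreal (norm (f s - \<phi> n s)) \<partial>M) \<longlonglongrightarrow> 0 \<and>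
          (\<lambda>n. Bochner_Integration.simple_bochner_integral M (\<phi> n)) \<longlonglongrightarrow> I)"

definition vector_bochner_integrable ::
    "'a measure \<Rightarrow> ('a \<Rightarrow> 'b :: real_normed_vector) \<Rightarrow> bool" where
  "vector_bochner_integrable M f \<longleftrightarrow> (\<exists>I. has_vector_bochner_integral M f I)"

definition vector_bochner_integral ::
    "'a measure \<Rightarrow> ('a \<Rightarrow> 'b :: real_normed_vector) \<Rightarrow> 'b" where
  "vector_bochner_integral M f = (THE I. has_vector_bochner_integral M f I)"

section \<open>Bochner spaces and operators between them\<close>

definition ennreal_powr :: "ennreal \<Rightarrow> real \<Rightarrow> ennreal" where
  "ennreal_powr a r = (if a = \<infinity> then \<infinity> else ennreal (enn2real a powr r))"

text \<open>The usual convention \<open>0\<^sup>0 = 1\<close>, in contrast to \<open>0 powr 0 = 0\<close>.\<close>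

definition real_pow :: "real \<Rightarrow> real \<Rightarrow> real" where
  "real_pow a r = (if r = 0 then 1 else a powr r)"

definition Lp_norm :: "'a measure \<Rightarrow> real \<Rightarrow> ('a \<Rightarrow> 'b :: real_normed_vector) \<Rightarrow> ennreal" where
  "Lp_norm M p f = ennreal_powr (\<integral>\<^sup>+ s. ennreal (norm (f s) powr p) \<partial>M) (1 / p)"

definition Lp_funs :: "'a measure \<Rightarrow> real \<Rightarrow> ('a \<Rightarrow> 'b :: real_normed_vector) set" where
  "Lp_funs M p = {f. strongly_measurable M f \<and> Lp_norm M p f < \<infinity>}"

text \<open>
  Elements of \<open>L\<^sub>p\<close> are represented by functions. An operator is required to respect equality
  almost everywhere and to be linear almost everywhere, i.e. to be a linear operator on the
  equivalence classes.
\<close>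

definition bounded_Lp_operator ::
    "'s measure \<Rightarrow> real \<Rightarrow> 't measure \<Rightarrow> real \<Rightarrow>
     (('s \<Rightarrow> 'x :: complex_normed_vector) \<Rightarrow> ('t \<Rightarrow> 'y :: complex_normed_vector)) \<Rightarrow> bool" where
  "bounded_Lp_operator M q N p K \<longleftrightarrow>
     (\<forall>f\<in>Lp_funs M q. K f \<in> Lp_funs N p) \<and>
     (\<forall>f\<in>Lp_funs M q. \<forall>g\<in>Lp_funs M q.
        (AE s in M. f s = g s) \<longrightarrow> (AE t in N. K f t = K g t)) \<and>
     (\<forall>f\<in>Lp_funs M q. \<forall>g\<in>Lp_funs M q. AE t in N. K (\<lambda>s. f s + g s) t = K f t + K g t) \<and>
     (\<forall>a. \<forall>f\<in>Lp_funs M q. AE t in N. K (\<lambda>s. a *\<^sub>C f s) t = a *\<^sub>C K f t) \<and>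
     (\<exists>B :: real. \<forall>f\<in>Lp_funs M q. Lp_norm N p (K f) \<le> ennreal B * Lp_norm M q f)"

definition Lp_operator_norm ::
    "'s measure \<Rightarrow> real \<Rightarrow> 't measure \<Rightarrow> real \<Rightarrow>
     (('s \<Rightarrow> 'x :: complex_normed_vector) \<Rightarrow> ('t \<Rightarrow> 'y :: complex_normed_vector)) \<Rightarrow> ennreal" where
  "Lp_operator_norm M q N p K =
     (SUP f\<in>{f \<in> Lp_funs M q. Lp_norm M q f \<le> 1}. Lp_norm N p (K f))"

section \<open>The conditions on the kernel\<close>

definition kernel_cond_A ::
    "'t measure \<Rightarrow> 's measure \<Rightarrow>
     ('t \<Rightarrow> 's \<Rightarrow> 'x :: complex_banach \<Rightarrow>\<^sub>L 'y :: complex_banach) \<Rightarrow> bool" where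
  "kernel_cond_A \<mu> \<nu> k \<longleftrightarrow> (\<forall>A\<in>finite_sets \<nu>. \<forall>x.
     (\<exists>T'\<in>full_sets \<mu>. \<forall>t\<in>T'.
        vector_bochner_integrable \<nu> (\<lambda>s. indicator A s *\<^sub>R blinfun_apply (k t s) x)) \<and>
     strongly_measurable \<mu>
       (\<lambda>t. vector_bochner_integral \<nu> (\<lambda>s. indicator A s *\<^sub>R blinfun_apply (k t s) x)))"

definition kernel_cond_B ::
    "'t measure \<Rightarrow> 's measure \<Rightarrow> real \<Rightarrow> real \<Rightarrow>
     ('t \<Rightarrow> 's \<Rightarrow> 'x :: complex_banach \<Rightarrow>\<^sub>L 'y :: complex_banach) \<Rightarrow> bool" where
  "kernel_cond_B \<mu> \<nu> \<theta> C1 k \<longleftrightarrow> (\<forall>x.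
     (\<lambda>(t, s). norm (blinfun_apply (k t s) x) powr \<theta>) \<in> borel_measurable (\<mu> \<Otimes>\<^sub>M \<nu>) \<and>
     (\<exists>S'\<in>full_sets \<nu>. \<forall>s\<in>S'.
        ennreal_powr (\<integral>\<^sup>+ t. ennreal (norm (blinfun_apply (k t s) x) powr \<theta>) \<partial>\<mu>) (1 / \<theta>)
          \<le> ennreal (C1 * norm x)))"

definition kernel_cond_C ::
    "'t measure \<Rightarrow> 's measure \<Rightarrow> real \<Rightarrow> real \<Rightarrow> ('y \<Rightarrow>\<^sub>L complex) set \<Rightarrow>
     ('t \<Rightarrow> 's \<Rightarrow> 'x :: complex_banach \<Rightarrow>\<^sub>L 'y :: complex_banach) \<Rightarrow> bool" where
  "kernel_cond_C \<mu> \<nu> \<theta> C2 Z k \<longleftrightarrow> (\<forall>y'\<in>Z. \<exists>T'\<in>full_sets \<mu>. \<forall>t\<in>T'.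
     strongly_measurable \<nu> (\<lambda>s. norm (dual_adjoint (k t s) y') powr \<theta>) \<and>
     ennreal_powr (\<integral>\<^sup>+ s. ennreal (norm (dual_adjoint (k t s) y') powr \<theta>) \<partial>\<nu>) (1 / \<theta>)
       \<le> ennreal (C2 * norm y'))"

end

theory Submission
  imports Defs
begin

text \<open>
  Write \<open>\<lambda> = \<theta> / p\<close>. Condition (B) bounds \<open>K\<close> from \<open>L\<^sub>1\<close> to \<open>L\<^sub>\<theta>\<close> and condition (C) bounds it from
  \<open>L\<^bsub>\<theta>'\<^esub>\<close> to \<open>L\<^sub>\<infinity>\<close>. In place of Riesz-Thorin, a simple \<open>f\<close> is split for each \<open>\<sigma> > 0\<close> as
  \<open>f = (1 - \<lambda>) \<sigma>\<^sup>\<lambda> g + \<lambda> \<sigma>\<^bsup>\<lambda>-1\<^esup> h\<close>, where \<open>g\<close> and \<open>h\<close> are scalar multiples of \<open>f\<close> with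
  \<open>\<parallel>g\<parallel> \<le> \<parallel>f\<parallel>\<^bsup>q/\<theta>'\<^esup>\<close> and \<open>\<parallel>h\<parallel> \<le> \<parallel>f\<parallel>\<^sup>q\<close>; the weighted AM-GM inequality makes this possible.
  With \<open>A\<close> the \<open>L\<^sub>\<infinity>\<close> bound of \<open>K g\<close> and \<open>B(t) = \<integral> \<parallel>f\<parallel>\<^bsup>q-1\<^esup> \<parallel>k(t,s) f(s)\<parallel> d\<nu>(s)\<close>, optimising over
  \<open>\<sigma>\<close> separately at each \<open>t\<close> gives \<open>\<parallel>K f(t)\<parallel> \<le> A\<^bsup>1-\<lambda>\<^esup> B(t)\<^sup>\<lambda>\<close>, and \<open>\<parallel>B\<parallel>\<^sub>\<theta> \<le> C\<^sub>1 \<parallel>f\<parallel>\<^sub>q\<^sup>q\<close> by Hoelder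
  and Tonelli. The measure \<open>\<mu>\<close> need not be \<open>\<sigma>\<close>-finite, but \<open>K f\<close> is strongly measurable and hence
  lives on a \<open>\<sigma>\<close>-finite set. Norms of strongly measurable functions are measurable only up to null
  sets, so integrals are computed in the completion of the measure.
\<close>

subsection \<open>Simple functions and strong measurability\<close>

lemma simple_bochner_integrable_indicator:
  assumes "A \<in> finite_sets M"
  shows "Bochner_Integration.simple_bochner_integrable M (\<lambda>s. indicator A s *\<^sub>R x)"
proof
  have A: "A \<in> sets M" "emeasure M A < \<infinity>" using assms by (auto simp: finite_sets_def)
  show "simple_function M (\<lambda>s. indicator A s *\<^sub>R x)"
    using simple_function_compose1[OF simple_function_indicator[OF A(1)], of "\<lambda>r::real. r *\<^sub>R x"] by simp
  have "emeasure M {y \<in> space M. indicator A y *\<^sub>R x \<noteq> 0} \<le> emeasure M A"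
    using A by (intro emeasure_mono) (auto simp: indicator_def)
  with A show "emeasure M {y \<in> space M. indicator A y *\<^sub>R x \<noteq> 0} \<noteq> \<infinity>"
    by auto
qed

text \<open>Links \<open>simple_funs\<close> with \<open>simple_bochner_integrable\<close>, so that
  closure properties and integrals of simple functions can be taken from there. The clause about
  points outside \<open>space M\<close> is needed because the sets \<open>A i\<close> lie in the
  space, whereas the other predicate sees only the values on \<open>space M\<close>.\<close>

lemma simple_funs_iff:
  "f \<in> simple_funs M \<longleftrightarrow> Bochner_Integration.simple_bochner_integrable M f \<and> (\<forall>s. s \<notin> space M \<longrightarrow> f s = 0)"
proof
  assume "f \<in> simple_funs M"
  then obtain n :: nat and x A where A: "\<And>i. i < n \<Longrightarrow> A i \<in> finite_sets M"
    and f: "f = (\<lambda>s. \<Sum>i<n. indicator (A i) s *\<^sub>R x i)"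
    unfolding simple_funs_def by blast
  have "Bochner_Integration.simple_bochner_integrable M (\<lambda>s. \<Sum>i<n. indicator (A i) s *\<^sub>R x i)"
    using A
  proof (induction n)
    case 0
    then show ?case using simple_bochner_integrable_indicator[of "{}" M 0] by (simp add: finite_sets_def)
  next
    case (Suc n)
    have "Bochner_Integration.simple_bochner_integrable M
        (\<lambda>s. (\<Sum>i<n. indicator (A i) s *\<^sub>R x i) + indicator (A n) s *\<^sub>R x n)"
      using Suc by (intro simple_bochner_integrable_compose2[of "(+)"] simple_bochner_integrable_indicator) auto
    then show ?case by (simp only: sum.lessThan_Suc)
  qed
  moreover have "f s = 0" if "s \<notin> space M" for s
  proof -
    have "s \<notin> A i" if "i < n" for i
      using A[OF that] \<open>s \<notin> space M\<close> sets.sets_into_space[of "A i" M] by (auto simp: finite_sets_def)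
    then show ?thesis unfolding f by (intro sum.neutral) auto
  qed
  ultimately show "Bochner_Integration.simple_bochner_integrable M f \<and> (\<forall>s. s \<notin> space M \<longrightarrow> f s = 0)"
    using f by auto
next
  assume a: "Bochner_Integration.simple_bochner_integrable M f \<and> (\<forall>s. s \<notin> space M \<longrightarrow> f s = 0)"
  then have sf: "simple_function M f" and fin: "emeasure M {y\<in>space M. f y \<noteq> 0} \<noteq> \<infinity>"
    by (auto simp: simple_bochner_integrable.simps)
  have [measurable]: "f \<in> measurable M (count_space UNIV)"
    using sf by (rule measurable_simple_function)
  \<comment> \<open>The value 0 is left out because its level set may have infinite measure; every
    other level set lies in the support.\<close>
  define R where "R = f ` space M - {0}"
  have finR: "finite R" using sf by (auto simp: R_def simple_function_def)
  obtain h where h: "bij_betw h {0..<card R} R"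
    using ex_bij_betw_nat_finite[OF finR] by blast
  define A where "A i = {s\<in>space M. f s = h i}" for i
  have "A i \<in> finite_sets M" if "i < card R" for i
  proof -
    have "h i \<noteq> 0" using h that by (auto simp: R_def bij_betw_def)
    then have "emeasure M (A i) \<le> emeasure M {y\<in>space M. f y \<noteq> 0}"
      unfolding A_def by (intro emeasure_mono) auto
    with fin show ?thesis
      by (auto simp: finite_sets_def A_def less_top[symmetric] top_unique)
  qed
  moreover have "f s = (\<Sum>i<card R. indicator (A i) s *\<^sub>R h i)" for s
  proof -
    have "(\<Sum>i<card R. indicator (A i) s *\<^sub>R h i) = (\<Sum>y\<in>R. indicator {s\<in>space M. f s = y} s *\<^sub>R y)"
      unfolding A_def lessThan_atLeast0 by (rule sum.reindex_bij_betw[OF h])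
    also have "\<dots> = (\<Sum>y\<in>R. if y = f s then f s else 0)"
      using a by (intro sum.cong) (auto simp: indicator_def R_def)
    also have "\<dots> = f s"
      using finR a by (auto simp: R_def)
    finally show ?thesis by simp
  qed
  ultimately show "f \<in> simple_funs M"
    unfolding simple_funs_def by blast
qed

lemma simple_funs_zero: "(\<lambda>s. 0) \<in> simple_funs M"
  unfolding simple_funs_def by (rule CollectI, rule exI[of _ 0]) simp

lemma simple_funs_compose2:
  assumes "f \<in> simple_funs M" "g \<in> simple_funs M" "h 0 0 = 0"
  shows "(\<lambda>s. h (f s) (g s)) \<in> simple_funs M"
  using assms simple_bochner_integrable_compose2[of h M f g] by (auto simp: simple_funs_iff)

lemma simple_funs_compose:
  assumes "f \<in> simple_funs M" "h 0 = 0"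
  shows "(\<lambda>s. h (f s)) \<in> simple_funs M"
  using simple_funs_compose2[of f M f "\<lambda>x _. h x"] assms by simp

lemma simple_funs_add: "f \<in> simple_funs M \<Longrightarrow> g \<in> simple_funs M \<Longrightarrow> (\<lambda>s. f s + g s) \<in> simple_funs M"
  by (rule simple_funs_compose2[of _ _ _ "(+)"]) auto

lemma simple_funs_diff: "f \<in> simple_funs M \<Longrightarrow> g \<in> simple_funs M \<Longrightarrow> (\<lambda>s. f s - g s) \<in> simple_funs M"
  by (rule simple_funs_compose2[of _ _ _ "(-)"]) auto

lemma simple_funs_restrict:
  assumes "f \<in> simple_funs M" "A \<in> sets M"
  shows "(\<lambda>s. if s \<in> A then f s else 0) \<in> simple_funs M"
proof -
  have f: "simple_function M f" "emeasure M {y\<in>space M. f y \<noteq> 0} \<noteq> \<infinity>"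
    using assms by (auto simp: simple_funs_iff simple_bochner_integrable.simps)
  have [measurable]: "f \<in> measurable M (count_space UNIV)"
    using f(1) by (rule measurable_simple_function)
  have "simple_function M (\<lambda>s. if s \<in> A then f s else 0)"
    using assms f by (intro simple_function_If_set) (auto dest: sets.sets_into_space simp: Int_absorb2)
  moreover have "emeasure M {y\<in>space M. (if y \<in> A then f y else 0) \<noteq> 0} \<le> emeasure M {y\<in>space M. f y \<noteq> 0}"
    by (intro emeasure_mono) auto
  ultimately have "Bochner_Integration.simple_bochner_integrable M (\<lambda>s. if s \<in> A then f s else 0)"
    using f(2) by (intro simple_bochner_integrable.intros) (auto simp only: top_unique infinity_ennreal_def)
  then show ?thesis
    using assms by (auto simp: simple_funs_iff)
qed

lemma simple_funs_borel_measurable: "f \<in> simple_funs M \<Longrightarrow> f \<in> borel_measurable M"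
  by (auto simp: simple_funs_iff simple_bochner_integrable.simps borel_measurable_simple_function)

lemma simple_funs_finite_range:
  assumes "f \<in> simple_funs M" shows "finite (range f)"
proof -
  have "range f \<subseteq> insert 0 (f ` space M)" using assms by (auto simp: simple_funs_iff)
  moreover have "finite (f ` space M)"
    using assms by (simp add: simple_funs_iff simple_bochner_integrable.simps simple_function_def)
  ultimately show ?thesis by (rule finite_subset[OF _ finite.insertI])
qed

lemma simple_funs_support:
  assumes "f \<in> simple_funs M"
  shows "{s\<in>space M. f s \<noteq> 0} \<in> finite_sets M"
proof -
  have sf: "simple_function M f" and fin: "emeasure M {s\<in>space M. f s \<noteq> 0} \<noteq> \<infinity>"
    using assms by (auto simp: simple_funs_iff simple_bochner_integrable.simps)
  have [measurable]: "f \<in> measurable M (count_space UNIV)" using sf by (rule measurable_simple_function)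
  have "{s\<in>space M. f s \<noteq> 0} \<in> sets M" by measurable
  with fin show ?thesis by (simp add: finite_sets_def less_top)
qed

lemma strongly_measurable_simple: "f \<in> simple_funs M \<Longrightarrow> strongly_measurable M f"
  unfolding strongly_measurable_def by (intro exI[of _ "\<lambda>_. f"]) auto

lemma strongly_measurable_cong_AE:
  assumes "strongly_measurable M f" "AE s in M. f s = g s"
  shows "strongly_measurable M g"
proof -
  obtain \<phi> where "\<And>n. \<phi> n \<in> simple_funs M" and ae: "AE s in M. (\<lambda>n. \<phi> n s) \<longlonglongrightarrow> f s"
    using assms(1) by (auto simp: strongly_measurable_def)
  moreover have "AE s in M. (\<lambda>n. \<phi> n s) \<longlonglongrightarrow> g s"
    using ae assms(2) by eventually_elim simp
  ultimately show ?thesis unfolding strongly_measurable_def by blast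
qed

lemma strongly_measurable_add:
  assumes "strongly_measurable M f" "strongly_measurable M g"
  shows "strongly_measurable M (\<lambda>s. f s + g s)"
proof -
  obtain \<phi> where \<phi>: "\<And>n. \<phi> n \<in> simple_funs M" "AE s in M. (\<lambda>n. \<phi> n s) \<longlonglongrightarrow> f s"
    using assms by (auto simp: strongly_measurable_def)
  obtain \<psi> where \<psi>: "\<And>n. \<psi> n \<in> simple_funs M" "AE s in M. (\<lambda>n. \<psi> n s) \<longlonglongrightarrow> g s"
    using assms by (auto simp: strongly_measurable_def)
  have "AE s in M. (\<lambda>n. \<phi> n s + \<psi> n s) \<longlonglongrightarrow> f s + g s"
    using \<phi>(2) \<psi>(2) by eventually_elim (rule tendsto_add)
  then show ?thesis unfolding strongly_measurable_def
    using simple_funs_add[OF \<phi>(1) \<psi>(1)] by (intro exI[of _ "\<lambda>n s. \<phi> n s + \<psi> n s"]) auto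
qed

lemma strongly_measurable_compose:
  assumes "strongly_measurable M f" "continuous_on UNIV h" "h 0 = 0"
  shows "strongly_measurable M (\<lambda>s. h (f s))"
proof -
  obtain \<phi> where \<phi>: "\<And>n. \<phi> n \<in> simple_funs M" "AE s in M. (\<lambda>n. \<phi> n s) \<longlonglongrightarrow> f s"
    using assms by (auto simp: strongly_measurable_def)
  have "AE s in M. (\<lambda>n. h (\<phi> n s)) \<longlonglongrightarrow> h (f s)"
    using \<phi>(2)
  proof eventually_elim
    case (elim s)
    then show ?case using continuous_on_tendsto_compose[OF assms(2) elim] by simp
  qed
  then show ?thesis unfolding strongly_measurable_def
    using simple_funs_compose[OF \<phi>(1), of h] assms(3) by (intro exI[of _ "\<lambda>n s. h (\<phi> n s)"]) auto
qed

lemma strongly_measurable_bounded_linear: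
  "bounded_linear h \<Longrightarrow> strongly_measurable M f \<Longrightarrow> strongly_measurable M (\<lambda>s. h (f s))"
  using strongly_measurable_compose[of M f h] linear_continuous_on[of h UNIV] linear_0[of h]
  by (simp add: bounded_linear.linear)

lemma strongly_measurable_diff:
  assumes "strongly_measurable M f" "strongly_measurable M g"
  shows "strongly_measurable M (\<lambda>s. f s - g s)"
  using strongly_measurable_add[OF assms(1) strongly_measurable_bounded_linear[OF
      bounded_linear_minus[OF bounded_linear_ident] assms(2)]] by simp

lemma strongly_measurable_zero: "strongly_measurable M (\<lambda>s. 0)"
  by (rule strongly_measurable_simple[OF simple_funs_zero])

lemma strongly_measurable_sum:
  "(\<And>i. i \<in> I \<Longrightarrow> strongly_measurable M (f i)) \<Longrightarrow> strongly_measurable M (\<lambda>s. \<Sum>i\<in>I. f i s)"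
  by (induction I rule: infinite_finite_induct)
    (simp_all add: strongly_measurable_add strongly_measurable_zero)

section \<open>Strongly measurable functions as Borel functions on the completion\<close>

text \<open>Convergence of the simple approximants may fail on a null set \<open>N\<close>. Setting
  \<open>f\<close> to 0 there gives a limit of simple functions at every point of the space, hence a
  Borel function, and \<open>f\<close> differs from it only on \<open>N\<close>, all of whose
  subsets are measurable in the completion.\<close>

lemma strongly_measurable_borel_completion:
  assumes "strongly_measurable M f"
  shows "f \<in> borel_measurable (completion M)"
proof -
  obtain \<phi> where \<phi>: "\<And>n. \<phi> n \<in> simple_funs M" "AE s in M. (\<lambda>n. \<phi> n s) \<longlonglongrightarrow> f s"
    using assms by (auto simp: strongly_measurable_def)
  obtain N where N: "N \<in> null_sets M" "{s\<in>space M. \<not> (\<lambda>n. \<phi> n s) \<longlonglongrightarrow> f s} \<subseteq> N"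
    using \<phi>(2) by (auto elim!: AE_E)
  define f' where "f' s = (if s \<in> N then 0 else f s)" for s
  have "f' \<in> borel_measurable M"
  proof (rule borel_measurable_LIMSEQ_metric)
    have "N \<in> sets M" using N by auto
    then show "(\<lambda>s. if s \<in> space M - N then \<phi> n s else 0) \<in> borel_measurable M" for n
      using \<phi>(1) by (intro simple_funs_borel_measurable simple_funs_restrict) auto
    show "(\<lambda>i. if s \<in> space M - N then \<phi> i s else 0) \<longlonglongrightarrow> f' s" if "s \<in> space M" for s
      using N that by (auto simp: f'_def)
  qed
  then have f': "f' \<in> borel_measurable (completion M)" by (rule measurable_completion)
  show ?thesis
  proof (rule measurableI)
    fix B :: "'b set" assume B: "B \<in> sets borel"
    have *: "f -` B \<inter> space (completion M) = (f' -` B \<inter> space (completion M) - N) \<union> (f -` B \<inter> N)"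
      using N(1) sets.sets_into_space[of N M] by (auto simp: f'_def split: if_splits)
    have "f -` B \<inter> N \<in> sets (completion M)"
      using N(1) sets_completionI[of "f -` B \<inter> N" "{}" "f -` B \<inter> N" N M] by auto
    moreover have "N \<in> sets (completion M)" using N(1) by auto
    ultimately show "f -` B \<inter> space (completion M) \<in> sets (completion M)"
      unfolding * using measurable_sets[OF f' B] by (intro sets.Un sets.Diff) auto
  qed simp
qed

lemma strongly_measurable_norm_borel:
  "strongly_measurable M f \<Longrightarrow> (\<lambda>s. norm (f s)) \<in> borel_measurable (completion M)"
  using borel_measurable_continuous_on[OF continuous_on_norm[OF continuous_on_id]]
    strongly_measurable_borel_completion by blast

subsection \<open>The Bochner integral\<close>

lemma ennreal_tendsto_0_le:
  fixes a b :: "'a \<Rightarrow> ennreal"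
  assumes "\<And>n. a n \<le> b n" "(b \<longlongrightarrow> 0) F"
  shows "(a \<longlongrightarrow> 0) F"
  by (rule tendsto_sandwich[OF _ _ tendsto_const assms(2)]) (auto simp: assms(1))

lemma norm_simple_bochner_integral_le:
  assumes "\<phi> \<in> simple_funs M"
  shows "ennreal (norm (Bochner_Integration.simple_bochner_integral M \<phi>)) \<le> (\<integral>\<^sup>+ s. ennreal (norm (\<phi> s)) \<partial>M)"
proof -
  have \<phi>: "Bochner_Integration.simple_bochner_integrable M \<phi>" using assms by (auto simp: simple_funs_iff)
  have n: "Bochner_Integration.simple_bochner_integrable M (\<lambda>s. norm (\<phi> s))"
    using simple_funs_compose[OF assms, of norm] by (auto simp: simple_funs_iff)
  have "ennreal (norm (Bochner_Integration.simple_bochner_integral M \<phi>)) \<le> ennreal (Bochner_Integration.simple_bochner_integral M (\<lambda>s. norm (\<phi> s)))"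
    by (intro ennreal_leI simple_bochner_integral_norm_bound \<phi>)
  also have "\<dots> = (\<integral>\<^sup>+ s. ennreal (norm (\<phi> s)) \<partial>M)"
    using simple_bochner_integral_eq_nn_integral[OF n] by simp
  finally show ?thesis .
qed

text \<open>Additivity needs measurable integrands, which the completion provides; the nonnegative
  integral has the same value over \<open>M\<close> and over its completion.\<close>

lemma nn_integral_norm_add_le:
  assumes "strongly_measurable M f" "strongly_measurable M g"
  shows "(\<integral>\<^sup>+ s. ennreal (norm (f s + g s)) \<partial>M)
    \<le> (\<integral>\<^sup>+ s. ennreal (norm (f s)) \<partial>M) + (\<integral>\<^sup>+ s. ennreal (norm (g s)) \<partial>M)"
proof -
  note [measurable] = assms[THEN strongly_measurable_norm_borel]
  have "(\<integral>\<^sup>+ s. ennreal (norm (f s + g s)) \<partial>completion M)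
    \<le> (\<integral>\<^sup>+ s. ennreal (norm (f s)) + ennreal (norm (g s)) \<partial>completion M)"
    by (intro nn_integral_mono) (simp flip: ennreal_plus add: norm_triangle_ineq)
  also have "\<dots> = (\<integral>\<^sup>+ s. ennreal (norm (f s)) \<partial>completion M) + (\<integral>\<^sup>+ s. ennreal (norm (g s)) \<partial>completion M)"
    by (rule nn_integral_add) auto
  finally show ?thesis by (simp only: nn_integral_completion)
qed

text \<open>Known for simple functions; the approximants differ from \<open>f\<close> by an L_1
  error that tends to 0, so the estimate survives in the limit.\<close>

lemma has_vector_bochner_integral_norm_le:
  assumes "has_vector_bochner_integral M f I"
  shows "ennreal (norm I) \<le> (\<integral>\<^sup>+ s. ennreal (norm (f s)) \<partial>M)"
proof -
  obtain \<phi> where sm: "strongly_measurable M f" and \<phi>: "\<And>n. \<phi> n \<in> simple_funs M"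
    and lim: "(\<lambda>n. \<integral>\<^sup>+ s. ennreal (norm (f s - \<phi> n s)) \<partial>M) \<longlonglongrightarrow> 0"
    and limI: "(\<lambda>n. Bochner_Integration.simple_bochner_integral M (\<phi> n)) \<longlonglongrightarrow> I"
    using assms unfolding has_vector_bochner_integral_def by blast
  have le: "ennreal (norm (Bochner_Integration.simple_bochner_integral M (\<phi> n))) \<le>
      (\<integral>\<^sup>+ s. ennreal (norm (f s - \<phi> n s)) \<partial>M) + (\<integral>\<^sup>+ s. ennreal (norm (f s)) \<partial>M)" for n
  proof -
    have "ennreal (norm (Bochner_Integration.simple_bochner_integral M (\<phi> n))) \<le> (\<integral>\<^sup>+ s. ennreal (norm (\<phi> n s)) \<partial>M)"
      by (rule norm_simple_bochner_integral_le[OF \<phi>])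
    also have "\<dots> = (\<integral>\<^sup>+ s. ennreal (norm ((\<phi> n s - f s) + f s)) \<partial>M)" by simp
    also have "\<dots> \<le> (\<integral>\<^sup>+ s. ennreal (norm (\<phi> n s - f s)) \<partial>M) + (\<integral>\<^sup>+ s. ennreal (norm (f s)) \<partial>M)"
      by (intro nn_integral_norm_add_le strongly_measurable_diff sm strongly_measurable_simple \<phi>)
    finally show ?thesis by (simp add: norm_minus_commute)
  qed
  have "(\<lambda>n. ennreal (norm (Bochner_Integration.simple_bochner_integral M (\<phi> n)))) \<longlonglongrightarrow> ennreal (norm I)"
    by (intro tendsto_ennrealI tendsto_norm limI)
  moreover have "(\<lambda>n. (\<integral>\<^sup>+ s. ennreal (norm (f s - \<phi> n s)) \<partial>M) + (\<integral>\<^sup>+ s. ennreal (norm (f s)) \<partial>M))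
      \<longlonglongrightarrow> 0 + (\<integral>\<^sup>+ s. ennreal (norm (f s)) \<partial>M)"
    by (intro tendsto_add lim tendsto_const)
  ultimately show ?thesis using le LIMSEQ_le by (metis (no_types, lifting) add_0)
qed

lemma nn_integral_norm_simple_finite:
  assumes "\<phi> \<in> simple_funs M"
  shows "(\<integral>\<^sup>+ s. ennreal (norm (\<phi> s)) \<partial>M) < \<infinity>"
proof -
  have n: "Bochner_Integration.simple_bochner_integrable M (\<lambda>s. norm (\<phi> s))"
    using simple_funs_compose[OF assms, of norm] by (auto simp: simple_funs_iff)
  have "(\<integral>\<^sup>+ s. ennreal (norm (\<phi> s)) \<partial>M) = ennreal (Bochner_Integration.simple_bochner_integral M (\<lambda>s. norm (\<phi> s)))"
    using simple_bochner_integral_eq_nn_integral[OF n] by simp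
  then show ?thesis by simp
qed

lemma has_vector_bochner_integral_finite:
  assumes "has_vector_bochner_integral M f I"
  shows "(\<integral>\<^sup>+ s. ennreal (norm (f s)) \<partial>M) < \<infinity>"
proof -
  obtain \<phi> where sm: "strongly_measurable M f" and \<phi>: "\<And>n. \<phi> n \<in> simple_funs M"
    and lim: "(\<lambda>n. \<integral>\<^sup>+ s. ennreal (norm (f s - \<phi> n s)) \<partial>M) \<longlonglongrightarrow> 0"
    using assms unfolding has_vector_bochner_integral_def by blast
  obtain n where n: "(\<integral>\<^sup>+ s. ennreal (norm (f s - \<phi> n s)) \<partial>M) < 1"
    using order_tendstoD(2)[OF lim, of 1] by (auto simp: eventually_sequentially)
  have "(\<integral>\<^sup>+ s. ennreal (norm (f s)) \<partial>M) = (\<integral>\<^sup>+ s. ennreal (norm ((f s - \<phi> n s) + \<phi> n s)) \<partial>M)" by simp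
  also have "\<dots> \<le> (\<integral>\<^sup>+ s. ennreal (norm (f s - \<phi> n s)) \<partial>M) + (\<integral>\<^sup>+ s. ennreal (norm (\<phi> n s)) \<partial>M)"
    by (intro nn_integral_norm_add_le strongly_measurable_diff sm strongly_measurable_simple \<phi>)
  also have "\<dots> < \<infinity>"
    using n nn_integral_norm_simple_finite[OF \<phi>, of n] by (auto simp: less_top[symmetric])
  finally show ?thesis .
qed

lemma has_vector_bochner_integralI:
  assumes "strongly_measurable M f" "\<And>n. \<phi> n \<in> simple_funs M"
    "(\<lambda>n. \<integral>\<^sup>+ s. ennreal (norm (f s - \<phi> n s)) \<partial>M) \<longlonglongrightarrow> 0"
    "(\<lambda>n. Bochner_Integration.simple_bochner_integral M (\<phi> n)) \<longlonglongrightarrow> I"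
  shows "has_vector_bochner_integral M f I"
  unfolding has_vector_bochner_integral_def using assms by blast

lemma has_vector_bochner_integral_add:
  assumes "has_vector_bochner_integral M f I" "has_vector_bochner_integral M g J"
  shows "has_vector_bochner_integral M (\<lambda>s. f s + g s) (I + J)"
proof -
  obtain \<phi> where sf: "strongly_measurable M f" and \<phi>: "\<And>n. \<phi> n \<in> simple_funs M"
    and limf: "(\<lambda>n. \<integral>\<^sup>+ s. ennreal (norm (f s - \<phi> n s)) \<partial>M) \<longlonglongrightarrow> 0"
    and limI: "(\<lambda>n. Bochner_Integration.simple_bochner_integral M (\<phi> n)) \<longlonglongrightarrow> I"
    using assms(1) unfolding has_vector_bochner_integral_def by blast
  obtain \<psi> where sg: "strongly_measurable M g" and \<psi>: "\<And>n. \<psi> n \<in> simple_funs M"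
    and limg: "(\<lambda>n. \<integral>\<^sup>+ s. ennreal (norm (g s - \<psi> n s)) \<partial>M) \<longlonglongrightarrow> 0"
    and limJ: "(\<lambda>n. Bochner_Integration.simple_bochner_integral M (\<psi> n)) \<longlonglongrightarrow> J"
    using assms(2) unfolding has_vector_bochner_integral_def by blast
  have le: "(\<integral>\<^sup>+ s. ennreal (norm ((f s + g s) - (\<phi> n s + \<psi> n s))) \<partial>M) \<le>
    (\<integral>\<^sup>+ s. ennreal (norm (f s - \<phi> n s)) \<partial>M) + (\<integral>\<^sup>+ s. ennreal (norm (g s - \<psi> n s)) \<partial>M)" for n
    using nn_integral_norm_add_le[OF strongly_measurable_diff[OF sf strongly_measurable_simple[OF \<phi>]]
        strongly_measurable_diff[OF sg strongly_measurable_simple[OF \<psi>]], of n n]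
    by (simp add: algebra_simps)
  have "(\<lambda>n. \<integral>\<^sup>+ s. ennreal (norm ((f s + g s) - (\<phi> n s + \<psi> n s))) \<partial>M) \<longlonglongrightarrow> 0"
    by (rule tendsto_sandwich[OF _ _ tendsto_const]) (use le tendsto_add[OF limf limg] in auto)
  moreover have "(\<lambda>n. Bochner_Integration.simple_bochner_integral M (\<lambda>s. \<phi> n s + \<psi> n s)) \<longlonglongrightarrow> I + J"
    using tendsto_add[OF limI limJ] \<phi> \<psi> by (simp add: simple_bochner_integral_add simple_funs_iff)
  ultimately show ?thesis unfolding has_vector_bochner_integral_def
    using simple_funs_add[OF \<phi> \<psi>] strongly_measurable_add[OF sf sg]
    by (intro conjI exI[of _ "\<lambda>n s. \<phi> n s + \<psi> n s"]) auto
qed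

text \<open>A bounded linear map enlarges the L_1 error of the approximants by at most the factor
  \<open>C\<close>. The rule serves for scalar multiples and for the functionals in
  \<open>Z\<close>.\<close>

lemma has_vector_bochner_integral_bounded_linear:
  assumes "bounded_linear h" "has_vector_bochner_integral M f I"
  shows "has_vector_bochner_integral M (\<lambda>s. h (f s)) (h I)"
proof -
  interpret h: bounded_linear h by fact
  obtain \<phi> where sf: "strongly_measurable M f" and \<phi>: "\<And>n. \<phi> n \<in> simple_funs M"
    and limf: "(\<lambda>n. \<integral>\<^sup>+ s. ennreal (norm (f s - \<phi> n s)) \<partial>M) \<longlonglongrightarrow> 0"
    and limI: "(\<lambda>n. Bochner_Integration.simple_bochner_integral M (\<phi> n)) \<longlonglongrightarrow> I"
    using assms(2) unfolding has_vector_bochner_integral_def by blast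
  obtain C where C: "C > 0" "\<And>x. norm (h x) \<le> norm x * C"
    using h.pos_bounded by blast
  have le: "(\<integral>\<^sup>+ s. ennreal (norm (h (f s) - h (\<phi> n s))) \<partial>M) \<le>
    ennreal C * (\<integral>\<^sup>+ s. ennreal (norm (f s - \<phi> n s)) \<partial>M)" for n
  proof -
    note [measurable] = strongly_measurable_norm_borel[OF strongly_measurable_diff[OF sf
      strongly_measurable_simple[OF \<phi>]], of n]
    have "(\<integral>\<^sup>+ s. ennreal (norm (h (f s) - h (\<phi> n s))) \<partial>completion M) \<le>
      (\<integral>\<^sup>+ s. ennreal C * ennreal (norm (f s - \<phi> n s)) \<partial>completion M)"
      using C by (intro nn_integral_mono) (simp flip: ennreal_mult add: h.diff[symmetric] mult.commute)
    also have "\<dots> = ennreal C * (\<integral>\<^sup>+ s. ennreal (norm (f s - \<phi> n s)) \<partial>completion M)"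
      by (rule nn_integral_cmult) auto
    finally show ?thesis by (simp only: nn_integral_completion)
  qed
  have "(\<lambda>n. ennreal C * (\<integral>\<^sup>+ s. ennreal (norm (f s - \<phi> n s)) \<partial>M)) \<longlonglongrightarrow> ennreal C * 0"
    by (intro ennreal_tendsto_cmult limf) auto
  then have "(\<lambda>n. \<integral>\<^sup>+ s. ennreal (norm (h (f s) - h (\<phi> n s))) \<partial>M) \<longlonglongrightarrow> 0"
    unfolding mult_zero_right by (rule ennreal_tendsto_0_le[OF le])
  moreover have "(\<lambda>n. Bochner_Integration.simple_bochner_integral M (\<lambda>s. h (\<phi> n s))) \<longlonglongrightarrow> h I"
  proof -
    have "Bochner_Integration.simple_bochner_integral M (\<lambda>s. h (\<phi> n s)) =
        h (Bochner_Integration.simple_bochner_integral M (\<phi> n))" for n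
      using \<phi>[of n] by (intro simple_bochner_integral_linear h.linear_axioms) (simp add: simple_funs_iff)
    then show ?thesis using h.tendsto[OF limI] by simp
  qed
  moreover have "(\<lambda>s. h (\<phi> n s)) \<in> simple_funs M" for n
    by (rule simple_funs_compose[OF \<phi>, of h]) (rule h.zero)
  ultimately show ?thesis
    using strongly_measurable_bounded_linear[OF assms(1) sf] by (intro has_vector_bochner_integralI)
qed

text \<open>The zero function f - f has integral I - J, which the norm bound forces to vanish. This
  justifies the definite description in \<open>vector_bochner_integral\<close>.\<close>

lemma has_vector_bochner_integral_unique:
  assumes "has_vector_bochner_integral M f I" "has_vector_bochner_integral M f J"
  shows "I = J"
proof -
  have "has_vector_bochner_integral M (\<lambda>s. f s + - f s) (I + - J)"
    by (intro has_vector_bochner_integral_add assms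
        has_vector_bochner_integral_bounded_linear[OF bounded_linear_minus[OF bounded_linear_ident]])
  from has_vector_bochner_integral_norm_le[OF this] show ?thesis by simp
qed

lemma vector_bochner_integral_eq:
  "has_vector_bochner_integral M f I \<Longrightarrow> vector_bochner_integral M f = I"
  unfolding vector_bochner_integral_def
  by (rule the_equality) (auto dest: has_vector_bochner_integral_unique)

lemma has_vector_bochner_integral_integral:
  "vector_bochner_integrable M f \<Longrightarrow> has_vector_bochner_integral M f (vector_bochner_integral M f)"
  unfolding vector_bochner_integrable_def by (auto dest: vector_bochner_integral_eq)

lemma has_vector_bochner_integral_zero: "has_vector_bochner_integral M (\<lambda>s. 0) 0"
  by (rule has_vector_bochner_integralI[OF strongly_measurable_zero simple_funs_zero])
    (simp_all add: simple_bochner_integral_def image_constant_conv)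

lemma has_vector_bochner_integral_sum:
  "(\<And>i. i \<in> I \<Longrightarrow> has_vector_bochner_integral M (f i) (J i)) \<Longrightarrow>
    has_vector_bochner_integral M (\<lambda>s. \<Sum>i\<in>I. f i s) (\<Sum>i\<in>I. J i)"
proof (induction I rule: infinite_finite_induct)
  case (insert i I)
  then have "has_vector_bochner_integral M (\<lambda>s. f i s + (\<Sum>i\<in>I. f i s)) (J i + (\<Sum>i\<in>I. J i))"
    by (intro has_vector_bochner_integral_add) simp_all
  with insert show ?case by simp
qed (simp_all add: has_vector_bochner_integral_zero)

subsection \<open>Bochner spaces\<close>

text \<open>Trades a bound on a p-th root for a bound on the integral below it. An infinite
  \<open>a\<close> is consistent with this, since both inequalities then fail.\<close>

lemma ennreal_powr_le_iff:
  assumes "p > 0" "c \<ge> 0"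
  shows "ennreal_powr a (1 / p) \<le> ennreal c \<longleftrightarrow> a \<le> ennreal (c powr p)"
proof (cases a)
  case (real r)
  have "r powr (1 / p) \<le> c \<longleftrightarrow> r \<le> c powr p"
  proof
    assume "r powr (1 / p) \<le> c"
    then have "(r powr (1 / p)) powr p \<le> c powr p" using assms by (intro powr_mono2) auto
    then show "r \<le> c powr p" using assms real by (simp add: powr_powr)
  next
    assume "r \<le> c powr p"
    then have "r powr (1 / p) \<le> (c powr p) powr (1 / p)" using assms real by (intro powr_mono2) auto
    then show "r powr (1 / p) \<le> c" using assms by (simp add: powr_powr)
  qed
  then show ?thesis using real assms by (simp add: ennreal_powr_def)
qed (auto simp: ennreal_powr_def top_unique)

lemma Lp_norm_le_iff:
  assumes "p > 0" "c \<ge> 0"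
  shows "Lp_norm M p f \<le> ennreal c \<longleftrightarrow> (\<integral>\<^sup>+ s. ennreal (norm (f s) powr p) \<partial>M) \<le> ennreal (c powr p)"
  unfolding Lp_norm_def by (rule ennreal_powr_le_iff[OF assms])

lemma Lp_norm_finiteE:
  assumes "Lp_norm M p f < \<infinity>"
  obtains c where "c \<ge> 0" "Lp_norm M p f = ennreal c"
  using assms by (cases "Lp_norm M p f") auto

lemma Lp_norm_cong_AE:
  assumes "AE s in M. norm (f s) = norm (g s)"
  shows "Lp_norm M p f = Lp_norm M p g"
proof -
  have "(\<integral>\<^sup>+ s. ennreal (norm (f s) powr p) \<partial>M) = (\<integral>\<^sup>+ s. ennreal (norm (g s) powr p) \<partial>M)"
    using assms by (intro nn_integral_cong_AE) (auto elim!: eventually_mono)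
  then show ?thesis by (simp add: Lp_norm_def)
qed

lemma strongly_measurable_powr_borel:
  "strongly_measurable M f \<Longrightarrow> (\<lambda>s. ennreal (norm (f s) powr p)) \<in> borel_measurable (completion M)"
  using strongly_measurable_norm_borel[of M f] by measurable

lemma Lp_norm_zero: "p > 0 \<Longrightarrow> Lp_norm M p (\<lambda>s. 0) = 0"
  by (simp add: Lp_norm_def ennreal_powr_def)

lemma Lp_norm_eq_0_AE:
  assumes "p > 0" "strongly_measurable M f" "Lp_norm M p f = 0"
  shows "AE s in M. f s = 0"
proof -
  have "(\<integral>\<^sup>+ s. ennreal (norm (f s) powr p) \<partial>M) \<le> ennreal (0 powr p)"
    using Lp_norm_le_iff[of p 0 M f] assms by simp
  then have "(\<integral>\<^sup>+ s. ennreal (norm (f s) powr p) \<partial>completion M) = 0"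
    using assms by (simp add: nn_integral_completion)
  then have "AE s in completion M. ennreal (norm (f s) powr p) = 0"
    using nn_integral_0_iff_AE[OF strongly_measurable_powr_borel[OF assms(2)]] by blast
  then have "AE s in completion M. f s = 0"
    by eventually_elim (metis ennreal_eq_0_iff norm_eq_zero not_le powr_gt_zero)
  then show ?thesis by (simp add: AE_completion_iff)
qed

lemma Lp_norm_le_mult:
  assumes "p > 0" "c \<ge> 0" "strongly_measurable M f" "AE s in M. norm (g s) \<le> c * norm (f s)"
  shows "Lp_norm M p g \<le> ennreal c * Lp_norm M p f"
proof (cases "Lp_norm M p f")
  case (real d)
  have "(\<integral>\<^sup>+ s. ennreal (norm (g s) powr p) \<partial>completion M)
      \<le> (\<integral>\<^sup>+ s. ennreal (c powr p) * ennreal (norm (f s) powr p) \<partial>completion M)"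
    using AE_completion[OF assms(4)]
  proof (intro nn_integral_mono_AE, eventually_elim)
    case (elim s)
    then have "norm (g s) powr p \<le> (c * norm (f s)) powr p" using assms(1) by (intro powr_mono2) auto
    then show ?case using assms(2) by (simp add: powr_mult ennreal_mult[symmetric])
  qed
  also have "\<dots> = ennreal (c powr p) * (\<integral>\<^sup>+ s. ennreal (norm (f s) powr p) \<partial>completion M)"
    by (intro nn_integral_cmult strongly_measurable_powr_borel assms)
  also have "\<dots> \<le> ennreal (c powr p) * ennreal (d powr p)"
    using Lp_norm_le_iff[of p d M f] assms real by (intro mult_left_mono) (auto simp: nn_integral_completion)
  also have "\<dots> = ennreal ((c * d) powr p)"
    using assms real by (simp add: powr_mult ennreal_mult)
  finally have "Lp_norm M p g \<le> ennreal (c * d)"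
    using Lp_norm_le_iff[of p "c * d" M g] assms real by (simp add: nn_integral_completion)
  then show ?thesis using real assms by (simp add: ennreal_mult)
next
  case top
  \<comment> \<open>The right-hand side is infinite unless \<open>c = 0\<close>, where the
    convention that 0 times \<infinity> is 0 makes it vanish; but then \<open>g\<close> is 0 almost
    everywhere.\<close>
  show ?thesis
  proof (cases "c = 0")
    case True
    have "Lp_norm M p g = Lp_norm M p (\<lambda>s. 0 :: 'c)"
      using assms(4) True by (intro Lp_norm_cong_AE) auto
    then show ?thesis using assms by (simp add: Lp_norm_zero)
  next
    case False
    then show ?thesis using top assms by (simp add: ennreal_mult_top)
  qed
qed

section \<open>Minkowski's inequality\<close>

text \<open>Convexity of the power is applied on the open half-line. If \<open>u\<close> or
  \<open>v\<close> is 0, the claim reduces to (r w)^p \<le> r w^p, which holds because r^p \<le> r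
  for r in [0, 1].\<close>

lemma powr_convex_combination_le:
  fixes u v t p :: real
  assumes "p \<ge> 1" "0 \<le> t" "t \<le> 1" "u \<ge> 0" "v \<ge> 0"
  shows "(t * u + (1 - t) * v) powr p \<le> t * u powr p + (1 - t) * v powr p"
proof -
  have le: "(r * w) powr p \<le> r * w powr p" if "0 \<le> r" "r \<le> 1" "w \<ge> 0" for r w :: real
  proof (cases "r = 0")
    case False
    then have "r powr p \<le> r powr 1" using that assms(1) by (intro powr_mono') auto
    then show ?thesis using that False by (simp add: powr_mult mult_right_mono)
  qed simp
  consider "u = 0" | "v = 0" | "u > 0" "v > 0" using assms by linarith
  then show ?thesis
  proof cases
    case 1 then show ?thesis using le[of "1 - t" v] assms by simp
  next
    case 2 then show ?thesis using le[of t u] assms by simp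
  next
    case 3
    show ?thesis
      using convex_onD[OF powr_convex[OF assms(1)], of "1 - t" u v] 3 assms by simp
  qed
qed

text \<open>The sum |f| + |g| equals (A + B) times a convex combination of |f| / A and |g| / B, with
  weights A / (A + B) and B / (A + B). Convexity of the p-th power, once integrated, leaves exactly
  (A + B)^p.\<close>

lemma Lp_norm_add_le:
  assumes p: "p \<ge> 1" and f: "strongly_measurable M f" and g: "strongly_measurable M g"
  shows "Lp_norm M p (\<lambda>s. f s + g s) \<le> Lp_norm M p f + Lp_norm M p g"
proof (cases "Lp_norm M p f = \<infinity> \<or> Lp_norm M p g = \<infinity>")
  case False
  then obtain a b where a: "a \<ge> 0" "Lp_norm M p f = ennreal a" and b: "b \<ge> 0" "Lp_norm M p g = ennreal b"
    by (metis Lp_norm_finiteE infinity_ennreal_def less_top)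
  note [measurable] = strongly_measurable_powr_borel[OF f, of p] strongly_measurable_powr_borel[OF g, of p]
  show ?thesis
  proof (rule ennreal_le_epsilon)
    fix e :: real assume e: "e > 0"
    \<comment> \<open>The slack \<open>e / 2\<close> makes both numbers positive even when a norm is
      0, so that they may serve as divisors.\<close>
    define A B t where "A = a + e / 2" and "B = b + e / 2" and "t = A / (A + B)"
    have A: "A > 0" "a \<le> A" and B: "B > 0" "b \<le> B" using a b e by (auto simp: A_def B_def)
    have t: "0 \<le> t" "t \<le> 1" and t': "1 - t = B / (A + B)"
      using A B by (auto simp: t_def field_simps)
    define cA cB where "cA = (A + B) powr p * t * A powr - p" and "cB = (A + B) powr p * (1 - t) * B powr - p"
    have c: "cA \<ge> 0" "cB \<ge> 0" using t by (auto simp: cA_def cB_def)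
    have pt: "norm (f s + g s) powr p \<le> cA * norm (f s) powr p + cB * norm (g s) powr p" for s
    proof -
      have "norm (f s + g s) powr p \<le> (norm (f s) + norm (g s)) powr p"
        using p by (intro powr_mono2 norm_triangle_ineq) auto
      also have "norm (f s) + norm (g s) = (A + B) * (t * (norm (f s) / A) + (1 - t) * (norm (g s) / B))"
      proof -
        have "A + B \<noteq> 0" using A B by simp
        then have "(A + B) * t = A" "(A + B) * (1 - t) = B" unfolding t' by (simp_all add: t_def)
        then show ?thesis using A B by (simp add: distrib_left flip: mult.assoc)
      qed
      also have "\<dots> powr p = (A + B) powr p * (t * (norm (f s) / A) + (1 - t) * (norm (g s) / B)) powr p"
        using A B t by (subst powr_mult) auto
      also have "\<dots> \<le> (A + B) powr p * (t * (norm (f s) / A) powr p + (1 - t) * (norm (g s) / B) powr p)"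
        using A B t p by (intro mult_left_mono powr_convex_combination_le) auto
      also have "\<dots> = cA * norm (f s) powr p + cB * norm (g s) powr p"
        using A B by (simp add: cA_def cB_def powr_divide powr_minus field_simps)
      finally show ?thesis .
    qed
    have "(\<integral>\<^sup>+ s. ennreal (norm (f s + g s) powr p) \<partial>completion M)
        \<le> (\<integral>\<^sup>+ s. ennreal cA * ennreal (norm (f s) powr p) + ennreal cB * ennreal (norm (g s) powr p) \<partial>completion M)"
      using pt c by (intro nn_integral_mono) (simp flip: ennreal_mult ennreal_plus)
    also have "\<dots> = ennreal cA * (\<integral>\<^sup>+ s. ennreal (norm (f s) powr p) \<partial>completion M)
        + ennreal cB * (\<integral>\<^sup>+ s. ennreal (norm (g s) powr p) \<partial>completion M)"
      using nn_integral_cmult[OF strongly_measurable_powr_borel[OF f, of p]]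
        nn_integral_cmult[OF strongly_measurable_powr_borel[OF g, of p]]
      by (subst nn_integral_add) auto
    also have "\<dots> \<le> ennreal cA * ennreal (A powr p) + ennreal cB * ennreal (B powr p)"
      using a b A B p Lp_norm_le_iff[of p A M f] Lp_norm_le_iff[of p B M g]
      by (intro add_mono mult_left_mono) (auto simp: nn_integral_completion)
    also have "\<dots> = ennreal (cA * A powr p + cB * B powr p)"
      using c by (simp add: ennreal_mult ennreal_plus)
    also have "cA * A powr p + cB * B powr p = (A + B) powr p"
      using A B by (simp add: cA_def cB_def powr_minus field_simps)
    finally have "Lp_norm M p (\<lambda>s. f s + g s) \<le> ennreal (A + B)"
      using Lp_norm_le_iff[of p "A + B" M "\<lambda>s. f s + g s"] A B p by (simp add: nn_integral_completion)
    also have "\<dots> = Lp_norm M p f + Lp_norm M p g + ennreal e"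
      using a b e by (simp add: A_def B_def flip: ennreal_plus)
    finally show "Lp_norm M p (\<lambda>s. f s + g s) \<le> Lp_norm M p f + Lp_norm M p g + ennreal e" .
  qed
qed auto

lemma Lp_norm_minus_commute: "Lp_norm M p (\<lambda>s. f s - g s) = Lp_norm M p (\<lambda>s. g s - f s)"
  by (intro Lp_norm_cong_AE) (simp add: norm_minus_commute)

lemma Lp_norm_diff_triangle:
  assumes "p \<ge> 1" "strongly_measurable M f" "strongly_measurable M g" "strongly_measurable M h"
  shows "Lp_norm M p (\<lambda>s. f s - h s) \<le> Lp_norm M p (\<lambda>s. f s - g s) + Lp_norm M p (\<lambda>s. g s - h s)"
  using Lp_norm_add_le[OF assms(1) strongly_measurable_diff[OF assms(2,3)] strongly_measurable_diff[OF assms(3,4)]]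
  by simp

lemma Lp_norm_le_diff_add:
  assumes "p \<ge> 1" "strongly_measurable M f" "strongly_measurable M g"
  shows "Lp_norm M p f \<le> Lp_norm M p (\<lambda>s. f s - g s) + Lp_norm M p g"
  using Lp_norm_add_le[OF assms(1) strongly_measurable_diff[OF assms(2,3)] assms(3)] by simp

text \<open>Fatou's lemma in the completion.\<close>

lemma Lp_norm_lim_le:
  assumes p: "p > 0" "c \<ge> 0" and h: "\<And>n. strongly_measurable M (h n)"
    and lim: "AE s in M. (\<lambda>n. h n s) \<longlonglongrightarrow> g s" and le: "\<And>n. Lp_norm M p (h n) \<le> ennreal c"
  shows "Lp_norm M p g \<le> ennreal c"
proof -
  have "(\<integral>\<^sup>+ s. ennreal (norm (g s) powr p) \<partial>completion M)
    = (\<integral>\<^sup>+ s. liminf (\<lambda>n. ennreal (norm (h n s) powr p)) \<partial>completion M)"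
    using AE_completion[OF lim]
  proof (intro nn_integral_cong_AE, eventually_elim)
    case (elim s)
    have "(\<lambda>n. ennreal (norm (h n s) powr p)) \<longlonglongrightarrow> ennreal (norm (g s) powr p)"
      using p elim by (intro tendsto_ennrealI tendsto_powr' tendsto_norm tendsto_const) auto
    from lim_imp_Liminf[OF _ this] show ?case by simp
  qed
  also have "\<dots> \<le> liminf (\<lambda>n. \<integral>\<^sup>+ s. ennreal (norm (h n s) powr p) \<partial>completion M)"
    by (intro nn_integral_liminf strongly_measurable_powr_borel h)
  also have "\<dots> \<le> liminf (\<lambda>n::nat. ennreal (c powr p))"
    using le p by (intro Liminf_mono always_eventually) (simp add: nn_integral_completion Lp_norm_le_iff)
  also have "\<dots> = ennreal (c powr p)" by (simp add: Liminf_const)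
  finally show ?thesis using p by (simp add: Lp_norm_le_iff nn_integral_completion)
qed

lemma simple_funs_Lp:
  assumes "p > 0" "f \<in> simple_funs M"
  shows "f \<in> Lp_funs M p"
proof -
  have "(\<integral>\<^sup>+ s. ennreal (norm (norm (f s) powr p)) \<partial>M) < \<infinity>"
    by (intro nn_integral_norm_simple_finite simple_funs_compose[OF assms(2), of "\<lambda>x. norm x powr p"]) auto
  then have "Lp_norm M p f < \<infinity>" by (simp add: Lp_norm_def ennreal_powr_def)
  then show ?thesis using strongly_measurable_simple[OF assms(2)] by (simp add: Lp_funs_def)
qed

section \<open>Density of simple functions and completeness\<close>

text \<open>The approximants given by strong measurability have no common majorant. Cutting them off
  to 0 where their norm exceeds twice that of \<open>f\<close> keeps the convergence and bounds the
  error by 3 |f|, so dominated convergence applies to the p-th powers.\<close>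

lemma simple_funs_dense:
  assumes p: "p > 0" and f: "f \<in> Lp_funs M p" and e: "e > 0"
  shows "\<exists>\<phi>\<in>simple_funs M. Lp_norm M p (\<lambda>s. \<phi> s - f s) \<le> ennreal e"
proof -
  have sm: "strongly_measurable M f" and fin: "Lp_norm M p f < \<infinity>" using f by (auto simp: Lp_funs_def)
  obtain \<phi> where \<phi>: "\<And>n. \<phi> n \<in> simple_funs M" "AE s in M. (\<lambda>n. \<phi> n s) \<longlonglongrightarrow> f s"
    using sm by (auto simp: strongly_measurable_def)
  \<comment> \<open>The cut-off set has to lie in \<open>sets M\<close>, but the norm of
    \<open>f\<close> is measurable only in the completion; \<open>u\<close> is a Borel version of
    it.\<close>
  obtain u where u[measurable]: "u \<in> borel_measurable M" and fu: "AE s in M. norm (f s) = u s"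
    using completion_ex_borel_measurable_real[OF strongly_measurable_norm_borel[OF sm]] by blast
  define \<psi> where "\<psi> n s = (if s \<in> {s\<in>space M. norm (\<phi> n s) \<le> 2 * u s} then \<phi> n s else 0)" for n s
  have nm[measurable]: "(\<lambda>s. norm (\<phi> n s)) \<in> borel_measurable M" for n
    by (intro simple_funs_borel_measurable simple_funs_compose[OF \<phi>(1), of norm]) auto
  have \<psi>: "\<psi> n \<in> simple_funs M" for n
    unfolding \<psi>_def by (intro simple_funs_restrict \<phi>(1)) measurable
  have conv: "AE s in M. (\<lambda>n. \<psi> n s) \<longlonglongrightarrow> f s"
    using \<phi>(2) fu AE_space
  proof eventually_elim
    case (elim s)
    show ?case
    proof (cases "f s = 0")
      case True
      have "(\<lambda>n. norm (\<phi> n s)) \<longlonglongrightarrow> 0" using elim True by (simp add: tendsto_norm_zero)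
      then have "(\<lambda>n. \<psi> n s) \<longlonglongrightarrow> 0"
        by (rule Lim_null_comparison[rotated]) (auto simp: \<psi>_def)
      with True show ?thesis by simp
    next
      case False
      \<comment> \<open>Where \<open>f s\<close> is nonzero the factor 2 leaves room: the norms tend
        to |f s| < 2 |f s|, so eventually nothing is cut off.\<close>
      have "\<forall>\<^sub>F n in sequentially. norm (\<phi> n s) < 2 * norm (f s)"
        using False by (intro order_tendstoD(2)[OF tendsto_norm[OF elim(1)]]) simp
      then have "\<forall>\<^sub>F n in sequentially. \<phi> n s = \<psi> n s"
        using elim by (auto elim!: eventually_mono simp: \<psi>_def)
      then show ?thesis using elim(1) by (rule Lim_transform_eventually[rotated])
    qed
  qed
  have "(\<lambda>n. \<integral>\<^sup>+ s. ennreal (norm (\<psi> n s - f s) powr p) \<partial>completion M) \<longlonglongrightarrow>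
      (\<integral>\<^sup>+ s. 0 \<partial>completion M)"
  proof (rule nn_integral_dominated_convergence)
    show "(\<lambda>s. ennreal (norm (\<psi> n s - f s) powr p)) \<in> borel_measurable (completion M)" for n
      by (intro strongly_measurable_powr_borel strongly_measurable_diff strongly_measurable_simple \<psi> sm)
    show "(\<lambda>s. ennreal (3 powr p) * ennreal (norm (f s) powr p)) \<in> borel_measurable (completion M)"
      by (intro borel_measurable_times_ennreal borel_measurable_const strongly_measurable_powr_borel sm)
    show "AE s in completion M. ennreal (norm (\<psi> n s - f s) powr p) \<le> ennreal (3 powr p) * ennreal (norm (f s) powr p)" for n
      using AE_completion[OF fu]
    proof eventually_elim
      case (elim s)
      have "norm (\<psi> n s) \<le> 2 * norm (f s)"
        using elim by (auto simp: \<psi>_def norm_ge_zero[of "f s", unfolded elim])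
      then have "norm (\<psi> n s - f s) \<le> 3 * norm (f s)"
        using norm_triangle_ineq4[of "\<psi> n s" "f s"] by linarith
      then have "norm (\<psi> n s - f s) powr p \<le> (3 * norm (f s)) powr p"
        using p by (intro powr_mono2) auto
      then show ?case by (simp add: powr_mult ennreal_mult[symmetric])
    qed
    obtain c where c: "c \<ge> 0" "Lp_norm M p f = ennreal c" using fin by (rule Lp_norm_finiteE)
    have "(\<integral>\<^sup>+ s. ennreal (norm (f s) powr p) \<partial>M) \<le> ennreal (c powr p)"
      using c p Lp_norm_le_iff[of p c M f] by simp
    then have "(\<integral>\<^sup>+ s. ennreal (norm (f s) powr p) \<partial>M) < \<infinity>"
      by (rule le_less_trans) simp
    then show "(\<integral>\<^sup>+ s. ennreal (3 powr p) * ennreal (norm (f s) powr p) \<partial>completion M) < \<infinity>"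
      by (subst nn_integral_cmult[OF strongly_measurable_powr_borel[OF sm]])
        (simp add: nn_integral_completion ennreal_mult_less_top)
    show "AE s in completion M. (\<lambda>n. ennreal (norm (\<psi> n s - f s) powr p)) \<longlonglongrightarrow> 0"
      using AE_completion[OF conv]
    proof eventually_elim
      case (elim s)
      have "(\<lambda>n. norm (\<psi> n s - f s)) \<longlonglongrightarrow> 0" using elim by (intro tendsto_norm_zero LIM_zero)
      then have "(\<lambda>n. norm (\<psi> n s - f s) powr p) \<longlonglongrightarrow> 0 powr p"
        using p by (intro tendsto_powr' tendsto_const) auto
      then show ?case using tendsto_ennrealI by fastforce
    qed
  qed auto
  then have "(\<lambda>n. \<integral>\<^sup>+ s. ennreal (norm (\<psi> n s - f s) powr p) \<partial>M) \<longlonglongrightarrow> 0"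
    by (simp add: nn_integral_completion)
  then have "\<forall>\<^sub>F n in sequentially. (\<integral>\<^sup>+ s. ennreal (norm (\<psi> n s - f s) powr p) \<partial>M) < ennreal (e powr p)"
    using e by (intro order_tendstoD(2)) auto
  then obtain n where "(\<integral>\<^sup>+ s. ennreal (norm (\<psi> n s - f s) powr p) \<partial>M) < ennreal (e powr p)"
    by (auto simp: eventually_sequentially)
  then have "Lp_norm M p (\<lambda>s. \<psi> n s - f s) \<le> ennreal e"
    using p e by (simp add: Lp_norm_le_iff)
  with \<psi> show ?thesis by blast
qed

text \<open>The integrals of \<open>u n\<close> are dominated by a geometric series, so the sum of
  all \<open>u n\<close> is finite almost everywhere and \<open>u n s\<close> tends to 0. Hence the
  increments are eventually at most 2^(-n), and their telescoping series converges absolutely in the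
  Banach space.\<close>

lemma Lp_rapidly_Cauchy_AE_convergent:
  fixes \<psi> :: "nat \<Rightarrow> 'a \<Rightarrow> 'b :: banach"
  assumes p: "p \<ge> 1" and D: "D \<ge> 0" and \<psi>: "\<And>n. strongly_measurable M (\<psi> n)"
    and le: "\<And>n. Lp_norm M p (\<lambda>s. \<psi> n s - \<psi> (Suc n) s) \<le> ennreal (D * (1/4)^n)"
  shows "AE s in M. convergent (\<lambda>n. \<psi> n s)"
proof -
  \<comment> \<open>The weight 2^n splits the rate 4^(-n): a factor 2^(-n) remains for summing the
    integrals, and another one bounds the increment once \<open>u n s\<close> is below 1.\<close>
  define u where "u n s = ((2::real)^n * norm (\<psi> n s - \<psi> (Suc n) s)) powr p" for n s
  have sm: "strongly_measurable M (\<lambda>s. \<psi> n s - \<psi> (Suc n) s)" for n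
    by (intro strongly_measurable_diff \<psi>)
  have u_eq: "ennreal (u n s) = ennreal ((2^n) powr p) * ennreal (norm (\<psi> n s - \<psi> (Suc n) s) powr p)" for n s
    by (simp add: u_def powr_mult ennreal_mult)
  have um: "(\<lambda>s. ennreal (u n s)) \<in> borel_measurable (completion M)" for n
    unfolding u_eq by (intro borel_measurable_times_ennreal borel_measurable_const strongly_measurable_powr_borel sm)
  define c where "c = D powr p"
  have r: "0 \<le> (1/2) powr p" "(1/2) powr p < (1::real)"
    using p powr_less_mono2[of p "1/2" 1] by auto
  have int: "(\<integral>\<^sup>+ s. ennreal (u n s) \<partial>completion M) \<le> ennreal (c * ((1/2) powr p)^n)" for n
  proof -
    have "(\<integral>\<^sup>+ s. ennreal (u n s) \<partial>completion M) = ennreal ((2^n) powr p) *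
        (\<integral>\<^sup>+ s. ennreal (norm (\<psi> n s - \<psi> (Suc n) s) powr p) \<partial>completion M)"
      unfolding u_eq by (intro nn_integral_cmult strongly_measurable_powr_borel sm)
    also have "\<dots> \<le> ennreal ((2^n) powr p) * ennreal ((D * (1/4)^n) powr p)"
      using le[of n] p D by (intro mult_left_mono) (auto simp: Lp_norm_le_iff nn_integral_completion)
    also have "\<dots> = ennreal ((2^n * (D * (1/4)^n)) powr p)"
      using D by (simp add: powr_mult ennreal_mult)
    also have "2^n * (D * (1/4)^n) = D * (1/2)^n"
    proof -
      have "(2::real)^n * (1/4)^n = (1/2)^n" by (simp flip: power_mult_distrib)
      then show ?thesis by (simp add: mult.left_commute)
    qed
    also have "(D * (1/2)^n) powr p = c * ((1/2) powr p)^n"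
    proof -
      have "((1/2::real)^n) powr p = ((1/2) powr real n) powr p" by (subst powr_realpow) auto
      also have "\<dots> = ((1/2) powr p) powr real n" by (simp add: powr_powr mult.commute)
      also have "\<dots> = ((1/2) powr p)^n" by (subst powr_realpow) auto
      finally show ?thesis using D by (simp add: c_def powr_mult)
    qed
    finally show ?thesis .
  qed
  have "(\<integral>\<^sup>+ s. (\<Sum>n. ennreal (u n s)) \<partial>completion M) = (\<Sum>n. \<integral>\<^sup>+ s. ennreal (u n s) \<partial>completion M)"
    by (intro nn_integral_suminf um)
  also have "\<dots> \<le> (\<Sum>n. ennreal (c * ((1/2) powr p)^n))"
    by (intro suminf_le int) auto
  also have "\<dots> = ennreal (\<Sum>n. c * ((1/2) powr p)^n)"
    using r by (intro suminf_ennreal2 summable_mult summable_geometric) (auto simp: c_def)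
  finally have "(\<integral>\<^sup>+ s. (\<Sum>n. ennreal (u n s)) \<partial>completion M) \<noteq> \<infinity>"
    unfolding infinity_ennreal_def by (rule neq_top_trans[OF ennreal_neq_top])
  then have "AE s in completion M. (\<Sum>n. ennreal (u n s)) \<noteq> \<infinity>"
    by (intro nn_integral_noteq_infinite borel_measurable_suminf_order um)
  then have "AE s in completion M. convergent (\<lambda>n. \<psi> n s)"
  proof eventually_elim
    case (elim s)
    have "summable (\<lambda>n. u n s)"
      using elim by (intro summable_suminf_not_top) (auto simp: u_def)
    then have "(\<lambda>n. u n s) \<longlonglongrightarrow> 0" by (rule summable_LIMSEQ_zero)
    then have "\<forall>\<^sub>F n in sequentially. u n s < 1" by (rule order_tendstoD) simp
    then have "\<forall>\<^sub>F n in sequentially. norm (\<psi> (Suc n) s - \<psi> n s) \<le> (1/2)^n"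
    proof eventually_elim
      case (elim n)
      have "2^n * norm (\<psi> n s - \<psi> (Suc n) s) \<le> 1"
      proof (rule ccontr)
        assume "\<not> ?thesis"
        then have "1 \<le> u n s" unfolding u_def using p by (intro ge_one_powr_ge_zero) auto
        with elim show False by simp
      qed
      then have "norm (\<psi> n s - \<psi> (Suc n) s) \<le> 1 / 2^n"
        by (simp add: pos_le_divide_eq mult.commute)
      then show ?case by (simp add: norm_minus_commute power_divide)
    qed
    then have "summable (\<lambda>n. \<psi> (Suc n) s - \<psi> n s)"
      by (rule summable_comparison_test_ev) (simp add: summable_geometric)
    then have "convergent (\<lambda>n. \<psi> 0 s + (\<Sum>i<n. \<psi> (Suc i) s - \<psi> i s))"
      by (intro convergent_add convergent_const) (simp add: summable_iff_convergent)
    moreover have "\<psi> 0 s + (\<Sum>i<n. \<psi> (Suc i) s - \<psi> i s) = \<psi> n s" for n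
      unfolding sum_lessThan_telescope[of "\<lambda>i. \<psi> i s"] by simp
    ultimately show ?case by simp
  qed
  then show ?thesis by (simp add: AE_completion_iff)
qed

text \<open>The almost everywhere limit is also the L_p limit: sum the increments between
  \<open>n\<close> and \<open>n + j\<close>, then let \<open>j\<close> grow and apply Fatou.\<close>

lemma Lp_rapidly_Cauchy_converges:
  fixes \<psi> :: "nat \<Rightarrow> 'a \<Rightarrow> 'b :: banach"
  assumes p: "p \<ge> 1" and D: "D \<ge> 0" and \<psi>: "\<And>n. \<psi> n \<in> simple_funs M"
    and le: "\<And>n. Lp_norm M p (\<lambda>s. \<psi> n s - \<psi> (Suc n) s) \<le> ennreal (D * (1/4)^n)"
  shows "\<exists>g\<in>Lp_funs M p. (\<lambda>n. Lp_norm M p (\<lambda>s. \<psi> n s - g s)) \<longlonglongrightarrow> 0"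
proof -
  have sm: "strongly_measurable M (\<psi> n)" for n by (rule strongly_measurable_simple[OF \<psi>])
  have "AE s in M. convergent (\<lambda>n. \<psi> n s)"
    by (rule Lp_rapidly_Cauchy_AE_convergent[OF p D sm le])
  define g where "g s = lim (\<lambda>n. \<psi> n s)" for s
  have lim: "AE s in M. (\<lambda>n. \<psi> n s) \<longlonglongrightarrow> g s"
    using \<open>AE s in M. convergent (\<lambda>n. \<psi> n s)\<close> by eventually_elim (simp add: g_def convergent_LIMSEQ_iff)
  have g: "strongly_measurable M g" unfolding strongly_measurable_def using \<psi> lim by blast
  \<comment> \<open>Subtracting the last term makes the induction close: passing from
    \<open>j\<close> to \<open>j + 1\<close> raises the bound by (3/2) D 4^(-(n+j)), more than the
    increment D 4^(-(n+j)) that is added.\<close>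
  have *: "Lp_norm M p (\<lambda>s. \<psi> n s - \<psi> (n + j) s) \<le> ennreal (2 * D * (1/4)^n - 2 * D * (1/4)^(n+j))" for n j
  proof (induction j)
    case 0
    then show ?case using p by (simp add: Lp_norm_zero)
  next
    case (Suc j)
    have nn: "2 * D * (1/4)^n - 2 * D * (1/4)^(n+j) \<ge> 0"
      using D by (auto intro!: mult_left_mono power_decreasing)
    have "Lp_norm M p (\<lambda>s. \<psi> n s - \<psi> (n + Suc j) s) \<le>
      Lp_norm M p (\<lambda>s. \<psi> n s - \<psi> (n + j) s) + Lp_norm M p (\<lambda>s. \<psi> (n + j) s - \<psi> (n + Suc j) s)"
      by (intro Lp_norm_diff_triangle p sm)
    also have "\<dots> \<le> ennreal (2 * D * (1/4)^n - 2 * D * (1/4)^(n+j)) + ennreal (D * (1/4)^(n+j))"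
      using Suc le[of "n + j"] by (intro add_mono) auto
    also have "\<dots> = ennreal (2 * D * (1/4)^n - 2 * D * (1/4)^(n+j) + D * (1/4)^(n+j))"
      using nn D by (subst ennreal_plus) auto
    also have "\<dots> \<le> ennreal (2 * D * (1/4)^n - 2 * D * (1/4)^(n+Suc j))"
      using D by (intro ennreal_leI) simp
    finally show ?case .
  qed
  have bound: "Lp_norm M p (\<lambda>s. \<psi> n s - g s) \<le> ennreal (2 * D * (1/4)^n)" for n
  proof (rule Lp_norm_lim_le[of _ _ _ "\<lambda>j s. \<psi> n s - \<psi> (n + j) s"])
    show "AE s in M. (\<lambda>j. \<psi> n s - \<psi> (n + j) s) \<longlonglongrightarrow> \<psi> n s - g s"
      using lim
    proof eventually_elim
      case (elim s)
      have "(\<lambda>j. \<psi> (n + j) s) \<longlonglongrightarrow> g s"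
        using LIMSEQ_ignore_initial_segment[OF elim, of n] by (simp add: add.commute)
      then show ?case by (intro tendsto_diff tendsto_const)
    qed
    show "Lp_norm M p (\<lambda>s. \<psi> n s - \<psi> (n + j) s) \<le> ennreal (2 * D * (1/4)^n)" for j
      using D by (intro order_trans[OF *] ennreal_leI) auto
  qed (use p D sm in \<open>auto intro: strongly_measurable_diff\<close>)
  have "Lp_norm M p g \<le> Lp_norm M p (\<lambda>s. g s - \<psi> 0 s) + Lp_norm M p (\<psi> 0)"
    by (intro Lp_norm_le_diff_add p g sm)
  also have "\<dots> < \<infinity>"
    using bound[of 0] simple_funs_Lp[OF _ \<psi>[of 0], of p] p
    by (auto simp: Lp_funs_def Lp_norm_minus_commute[of M p g] less_top[symmetric] top_unique)
  finally have "g \<in> Lp_funs M p" using g by (simp add: Lp_funs_def)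
  moreover have "(\<lambda>n. Lp_norm M p (\<lambda>s. \<psi> n s - g s)) \<longlonglongrightarrow> 0"
  proof (rule ennreal_tendsto_0_le[OF bound])
    have "(\<lambda>n. ennreal (2 * D * (1/4)^n)) \<longlonglongrightarrow> ennreal (2 * D * 0)"
      by (intro tendsto_ennrealI tendsto_mult tendsto_const LIMSEQ_power_zero) auto
    then show "(\<lambda>n. ennreal (2 * D * (1/4)^n)) \<longlonglongrightarrow> 0" by simp
  qed
  ultimately show ?thesis by blast
qed

subsection \<open>Inequalities\<close>

lemma weighted_arith_geo_mean:
  fixes a b \<alpha> :: real
  assumes "0 \<le> \<alpha>" "\<alpha> \<le> 1" "a \<ge> 0" "b \<ge> 0"
  shows "a powr (1 - \<alpha>) * b powr \<alpha> \<le> (1 - \<alpha>) * a + \<alpha> * b"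
proof (cases "a = 0 \<or> b = 0")
  case False
  then show ?thesis using Youngs_inequality_0[of "1 - \<alpha>" \<alpha> a b] assms by simp
\<comment> \<open>As \<open>0 powr 0 = 0\<close>, the left-hand side vanishes when \<open>a\<close>
  or \<open>b\<close> is 0, even for \<alpha> = 0 or \<alpha> = 1.\<close>
qed (use assms in auto)

lemma nn_integral_powr_interpolation:
  fixes a b :: "'a \<Rightarrow> real"
  assumes \<alpha>: "0 < \<alpha>" "\<alpha> \<le> 1" and [measurable]: "a \<in> borel_measurable M" "b \<in> borel_measurable M"
    and nn: "\<And>s. a s \<ge> 0" "\<And>s. b s \<ge> 0" and A: "A > 0" and B: "B \<ge> 0"
    and a: "(\<integral>\<^sup>+ s. ennreal (a s) \<partial>M) \<le> ennreal A" and b: "(\<integral>\<^sup>+ s. ennreal (b s) \<partial>M) \<le> ennreal B"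
  shows "(\<integral>\<^sup>+ s. ennreal (a s powr (1 - \<alpha>) * b s powr \<alpha>) \<partial>M) \<le> ennreal (A powr (1 - \<alpha>) * B powr \<alpha>)"
proof (cases "B = 0")
  case True
  then have "AE s in M. ennreal (b s) = 0"
    using b by (subst (asm) True) (simp add: nn_integral_0_iff_AE)
  then have "AE s in M. ennreal (a s powr (1 - \<alpha>) * b s powr \<alpha>) = 0"
    by eventually_elim (use nn in \<open>auto simp: ennreal_eq_0_iff dest: antisym\<close>)
  then have "(\<integral>\<^sup>+ s. ennreal (a s powr (1 - \<alpha>) * b s powr \<alpha>) \<partial>M) = 0"
    by (subst nn_integral_0_iff_AE) auto
  then show ?thesis by simp
next
  case False
  with B have B: "B > 0" by simp
  define c where "c = A powr (1 - \<alpha>) * B powr \<alpha>"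
  have c: "c \<ge> 0" by (simp add: c_def)
  \<comment> \<open>Chosen so that d A = c (1 - \<alpha>) and e B = c \<alpha>, which add up to
    \<open>c\<close> after integration.\<close>
  define d e where "d = c * (1 - \<alpha>) / A" and "e = c * \<alpha> / B"
  have pt: "a s powr (1 - \<alpha>) * b s powr \<alpha> \<le> d * a s + e * b s" for s
  proof -
    have "a s powr (1 - \<alpha>) * b s powr \<alpha> = c * ((a s / A) powr (1 - \<alpha>) * (b s / B) powr \<alpha>)"
      using A B nn by (simp add: c_def powr_divide)
    also have "\<dots> \<le> c * ((1 - \<alpha>) * (a s / A) + \<alpha> * (b s / B))"
      using A B nn \<alpha> c by (intro mult_left_mono weighted_arith_geo_mean) auto
    finally show ?thesis by (simp add: d_def e_def algebra_simps)
  qed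
  have cc: "d \<ge> 0" "e \<ge> 0" using c \<alpha> A B by (auto simp: d_def e_def)
  have "(\<integral>\<^sup>+ s. ennreal (a s powr (1 - \<alpha>) * b s powr \<alpha>) \<partial>M) \<le>
    (\<integral>\<^sup>+ s. ennreal (d) * ennreal (a s) + ennreal (e) * ennreal (b s) \<partial>M)"
    using pt cc nn by (intro nn_integral_mono) (simp flip: ennreal_mult ennreal_plus)
  also have "\<dots> = ennreal (d) * (\<integral>\<^sup>+ s. ennreal (a s) \<partial>M)
      + ennreal (e) * (\<integral>\<^sup>+ s. ennreal (b s) \<partial>M)"
    by (subst nn_integral_add) (auto simp: nn_integral_cmult)
  also have "\<dots> \<le> ennreal (d) * ennreal A + ennreal (e) * ennreal B"
    by (intro add_mono mult_left_mono a b) auto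
  also have "\<dots> = ennreal (d * A + e * B)"
    using cc A B by (simp flip: ennreal_mult ennreal_plus)
  also have "d * A + e * B = c"
  proof -
    have "d * A = c * (1 - \<alpha>)" "e * B = c * \<alpha>" using A B by (simp_all add: d_def e_def)
    then show ?thesis by (simp add: algebra_simps)
  qed
  finally show ?thesis by (simp add: c_def)
qed

text \<open>
  The infimum over \<open>\<sigma>\<close> is attained at \<open>\<sigma> = B / A\<close>; only rational \<open>\<sigma>\<close> are admitted because
  each of them contributes an exceptional null set.
\<close>

lemma le_interpolation_if_le_all_rational:
  fixes N A B l :: real
  assumes l: "0 < l" "l \<le> 1" and A: "A \<ge> 0" and B: "B \<ge> 0"
    and le: "\<And>\<sigma>. \<sigma> \<in> \<rat> \<Longrightarrow> \<sigma> > 0 \<Longrightarrow> N \<le> (1 - l) * \<sigma> powr l * A + l * \<sigma> powr (l - 1) * B"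
  shows "N \<le> real_pow A (1 - l) * B powr l"
proof (cases "l = 1")
  case True
  then show ?thesis using le[of 1] B by (simp add: real_pow_def)
next
  case False
  with l have l1: "l < 1" by simp
  \<comment> \<open>Rationals decreasing to \<sigma> and continuity extend the hypothesis to all
    positive reals.\<close>
  have all: "N \<le> (1 - l) * \<sigma> powr l * A + l * \<sigma> powr (l - 1) * B" if "\<sigma> > 0" for \<sigma>
  proof -
    have "\<exists>r\<in>\<rat>. \<sigma> < r \<and> r < \<sigma> + inverse (real (Suc n))" for n
      by (rule Rats_dense_in_real) simp
    then obtain r where r: "\<And>n. r n \<in> \<rat>" "\<And>n. \<sigma> < r n" "\<And>n. r n < \<sigma> + inverse (real (Suc n))" by metis
    have "(\<lambda>n. \<sigma> + inverse (real (Suc n))) \<longlonglongrightarrow> \<sigma> + 0"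
      by (intro tendsto_add tendsto_const LIMSEQ_inverse_real_of_nat)
    then have u: "(\<lambda>n. \<sigma> + inverse (real (Suc n))) \<longlonglongrightarrow> \<sigma>" by simp
    have lim: "r \<longlonglongrightarrow> \<sigma>"
      by (rule tendsto_sandwich[OF _ _ tendsto_const u]) (use r in \<open>auto intro!: always_eventually less_imp_le\<close>)
    have "(\<lambda>n. (1 - l) * r n powr l * A + l * r n powr (l - 1) * B) \<longlonglongrightarrow> (1 - l) * \<sigma> powr l * A + l * \<sigma> powr (l - 1) * B"
      using that by (intro tendsto_add tendsto_mult tendsto_const tendsto_powr lim) auto
    then show ?thesis
      by (rule LIMSEQ_le_const) (use le r that in \<open>force intro: less_trans\<close>)
  qed
  \<comment> \<open>\<open>A\<close> and \<open>B\<close> may vanish, so the minimiser is formed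
    with slightly larger positive numbers, which then decrease to \<open>A\<close> and
    \<open>B\<close>.\<close>
  have eps: "N \<le> (A + inverse (real (Suc n))) powr (1 - l) * (B + inverse (real (Suc n))) powr l" for n
  proof -
    define a b where "a = A + inverse (real (Suc n))" and "b = B + inverse (real (Suc n))"
    have a: "a > 0" "A \<le> a" and b: "b > 0" "B \<le> b" using A B by (auto simp: a_def b_def add_nonneg_pos)
    have "N \<le> (1 - l) * (b / a) powr l * A + l * (b / a) powr (l - 1) * B"
      using a b by (intro all) auto
    also have "\<dots> \<le> (1 - l) * (b / a) powr l * a + l * (b / a) powr (l - 1) * b"
      using a b l by (intro add_mono mult_left_mono) auto
    also have "(b / a) powr l * a = a powr (1 - l) * b powr l"
      using a b by (simp add: powr_divide powr_diff)
    then have "(1 - l) * (b / a) powr l * a = (1 - l) * (a powr (1 - l) * b powr l)" by simp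
    also have "(b / a) powr (l - 1) * b = a powr (1 - l) * b powr l"
      using a b by (simp add: powr_divide powr_diff)
    then have "l * (b / a) powr (l - 1) * b = l * (a powr (1 - l) * b powr l)" by simp
    finally show ?thesis by (simp add: a_def b_def algebra_simps)
  qed
  have "(\<lambda>n. (A + inverse (real (Suc n))) powr (1 - l) * (B + inverse (real (Suc n))) powr l)
      \<longlonglongrightarrow> (A + 0) powr (1 - l) * (B + 0) powr l"
    using l l1 A B
    by (intro tendsto_mult tendsto_powr' tendsto_add tendsto_const LIMSEQ_inverse_real_of_nat)
      (auto intro!: always_eventually add_nonneg_nonneg)
  then have "N \<le> (A + 0) powr (1 - l) * (B + 0) powr l"
    by (rule LIMSEQ_le_const) (use eps in auto)
  then show ?thesis using l1 by (simp add: real_pow_def)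
qed

section \<open>Norm bounds from a norming set of functionals\<close>

text \<open>Each functional brings its own null set, so only countably many can be used. Almost
  every value of \<open>v\<close> is a limit of points of the countable set \<open>D\<close> of
  values of the approximants; for each point of \<open>D\<close> and each precision 1 / (m + 1) one
  nearly norming functional is enough.\<close>

lemma AE_norm_le_if_norming:
  fixes v :: "'t \<Rightarrow> 'y :: complex_banach"
  assumes Z: "csubspace Z" "norms_space \<tau> Z" and \<tau>: "\<tau> \<ge> 0" and v: "strongly_measurable M v"
    and le: "\<And>y'. y' \<in> Z \<Longrightarrow> norm y' \<le> 1 \<Longrightarrow> AE t in M. cmod (blinfun_apply y' (v t)) \<le> A"
  shows "AE t in M. norm (v t) \<le> \<tau> * A"
proof -
  obtain \<phi> where \<phi>: "\<And>n. \<phi> n \<in> simple_funs M" and lim: "AE t in M. (\<lambda>n. \<phi> n t) \<longlonglongrightarrow> v t"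
    using v by (auto simp: strongly_measurable_def)
  define D where "D = (\<Union>n. range (\<phi> n))"
  have D: "countable D" unfolding D_def
    by (intro countable_UN countableI_type countable_finite simple_funs_finite_range[OF \<phi>])
  have "\<exists>y'\<in>Z. norm y' \<le> 1 \<and> norm d \<le> \<tau> * (cmod (blinfun_apply y' d) + inverse (real (Suc m)))" for d m
  proof -
    let ?S = "{y'\<in>Z. norm y' \<le> 1}"
    let ?F = "\<lambda>y'. cmod (blinfun_apply y' d)"
    have ne: "?F ` ?S \<noteq> {}" using Z(1) by (auto simp: csubspace_def intro: exI[of _ 0])
    have "?F y' \<le> norm d" if "norm y' \<le> 1" for y'
      using norm_blinfun[of y' d] mult_right_mono[OF that, of "norm d"] by simp
    then have bdd: "bdd_above (?F ` ?S)" by (auto simp: bdd_above_def)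
    have "(SUP y'\<in>?S. ?F y') - inverse (real (Suc m)) < (SUP y'\<in>?S. ?F y')" by simp
    then obtain y' where y': "y' \<in> ?S" "(SUP y'\<in>?S. ?F y') - inverse (real (Suc m)) < ?F y'"
      using less_cSUP_iff[OF ne[unfolded image_is_empty] bdd] by blast
    have "norm d \<le> \<tau> * (SUP y'\<in>?S. ?F y')" using Z(2) by (simp add: norms_space_def)
    also have "\<dots> \<le> \<tau> * (?F y' + inverse (real (Suc m)))" using y' \<tau> by (intro mult_left_mono) auto
    finally show ?thesis using y' by blast
  qed
  then obtain Y where Y: "\<And>d m. Y d m \<in> Z" "\<And>d m. norm (Y d m) \<le> 1"
    "\<And>d m. norm d \<le> \<tau> * (cmod (blinfun_apply (Y d m) d) + inverse (real (Suc m)))" by metis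
  have "AE t in M. \<forall>d\<in>D. \<forall>m. cmod (blinfun_apply (Y d m) (v t)) \<le> A"
    using D by (intro AE_ball_countable[THEN iffD2] ballI AE_all_countable[THEN iffD2] allI le Y)
  then show ?thesis using lim
  proof eventually_elim
    case (elim t)
    \<comment> \<open>The index \<open>n\<close> selects both the approximant and the precision of
      its functional. The distance from \<open>d\<close> to \<open>v t\<close> is paid once in the
      norm and once, with factor \<tau>, inside the functional.\<close>
    have "norm (v t) \<le> (1 + \<tau>) * norm (\<phi> n t - v t) + \<tau> * (A + inverse (real (Suc n)))" for n
    proof -
      define d where "d = \<phi> n t"
      have "d \<in> D" by (auto simp: d_def D_def)
      have "cmod (blinfun_apply (Y d n) d) \<le> cmod (blinfun_apply (Y d n) (d - v t)) + cmod (blinfun_apply (Y d n) (v t))"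
        using norm_triangle_ineq[of "blinfun_apply (Y d n) (d - v t)" "blinfun_apply (Y d n) (v t)"]
        by (simp add: blinfun.diff_right)
      also have "cmod (blinfun_apply (Y d n) (d - v t)) \<le> norm (d - v t)"
        using norm_blinfun[of "Y d n" "d - v t"] mult_right_mono[OF Y(2)[of d n], of "norm (d - v t)"] by simp
      also have "cmod (blinfun_apply (Y d n) (v t)) \<le> A" using elim \<open>d \<in> D\<close> by blast
      finally have "cmod (blinfun_apply (Y d n) d) \<le> norm (d - v t) + A" by simp
      then have "\<tau> * (cmod (blinfun_apply (Y d n) d) + inverse (real (Suc n)))
          \<le> \<tau> * (norm (d - v t) + A + inverse (real (Suc n)))" using \<tau> by (intro mult_left_mono) auto
      then have "norm d \<le> \<tau> * (norm (d - v t) + A + inverse (real (Suc n)))" using Y(3)[of d n] by linarith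
      moreover have "norm (v t) \<le> norm (d - v t) + norm d"
        using norm_triangle_sub[of "v t" d] by (simp add: norm_minus_commute)
      ultimately show ?thesis by (simp add: d_def algebra_simps)
    qed
    moreover have "(\<lambda>n. (1 + \<tau>) * norm (\<phi> n t - v t) + \<tau> * (A + inverse (real (Suc n))))
        \<longlonglongrightarrow> (1 + \<tau>) * 0 + \<tau> * (A + 0)"
      by (intro tendsto_add tendsto_mult tendsto_const LIMSEQ_inverse_real_of_nat tendsto_norm_zero LIM_zero elim)
    ultimately show ?case using LIMSEQ_le_const by fastforce
  qed
qed

section \<open>Tonelli's theorem without \<sigma>-finiteness\<close>

text \<open>The sets are the supports of the simple approximants: where all of these vanish, so does
  their limit.\<close>

lemma strongly_measurable_sigma_finite_support:
  assumes "strongly_measurable M f"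
  obtains E :: "nat \<Rightarrow> 'a set" where "\<And>n. E n \<in> finite_sets M" "AE s in M. f s \<noteq> 0 \<longrightarrow> s \<in> (\<Union>n. E n)"
proof -
  obtain \<phi> where \<phi>: "\<And>n. \<phi> n \<in> simple_funs M" and lim: "AE s in M. (\<lambda>n. \<phi> n s) \<longlonglongrightarrow> f s"
    using assms by (auto simp: strongly_measurable_def)
  define E where "E n = {s\<in>space M. \<phi> n s \<noteq> 0}" for n
  have "E n \<in> finite_sets M" for n unfolding E_def by (rule simple_funs_support[OF \<phi>])
  moreover have "AE s in M. f s \<noteq> 0 \<longrightarrow> s \<in> (\<Union>n. E n)"
    using lim AE_space
  proof eventually_elim
    case (elim s)
    show ?case
    proof
      assume "f s \<noteq> 0"
      have "\<exists>n. \<phi> n s \<noteq> 0"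
      proof (rule ccontr)
        assume "\<not> ?thesis"
        then have "(\<lambda>n. \<phi> n s) \<longlonglongrightarrow> 0" by simp
        with elim(1) \<open>f s \<noteq> 0\<close> show False using LIMSEQ_unique by blast
      qed
      then show "s \<in> (\<Union>n. E n)" using elim by (auto simp: E_def)
    qed
  qed
  ultimately show thesis by (rule that)
qed

text \<open>Cutting down by a density leaves the space and the \<sigma>-algebra unchanged, so
  measurability on products carries over. The complement of the union has measure 0 for the new
  measure and completes the cover.\<close>

lemma sigma_finite_density_indicator:
  assumes E: "\<And>n::nat. E n \<in> finite_sets M"
  shows "sigma_finite_measure (density M (indicator (\<Union>n. E n)))"
proof
  have Es: "E n \<in> sets M" "emeasure M (E n) < \<infinity>" for n using E[of n] by (auto simp: finite_sets_def)
  let ?U = "\<Union>n. E n" and ?D = "density M (indicator (\<Union>n. E n))"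
  have U: "?U \<in> sets M" using Es by auto
  show "\<exists>A. countable A \<and> A \<subseteq> sets ?D \<and> \<Union> A = space ?D \<and> (\<forall>a\<in>A. emeasure ?D a \<noteq> \<infinity>)"
  proof (intro exI[of _ "insert (space M - ?U) (range E)"] conjI ballI)
    show "\<Union> (insert (space M - ?U) (range E)) = space ?D"
      using Es(1)[THEN sets.sets_into_space] by auto
    fix a assume "a \<in> insert (space M - ?U) (range E)"
    then consider "a = space M - ?U" | n where "a = E n" by auto
    then show "emeasure ?D a \<noteq> \<infinity>"
    proof cases
      case 1
      have "emeasure ?D a = (\<integral>\<^sup>+ x. indicator ?U x * indicator a x \<partial>M)"
        using U 1 by (intro emeasure_density) auto
      also have "\<dots> = (\<integral>\<^sup>+ x. 0 \<partial>M)" using 1 by (intro nn_integral_cong) (auto simp: indicator_def)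
      finally show ?thesis by simp
    next
      case 2
      have "emeasure ?D a = (\<integral>\<^sup>+ x. indicator ?U x * indicator a x \<partial>M)"
        using U 2 Es by (intro emeasure_density) auto
      also have "\<dots> \<le> (\<integral>\<^sup>+ x. indicator a x \<partial>M)" by (intro nn_integral_mono) (auto simp: indicator_def)
      also have "\<dots> < \<infinity>" using 2 Es by simp
      finally show ?thesis by simp
    qed
  qed (use U Es in auto)
qed

text \<open>Both measures become \<sigma>-finite once cut down to the union of the
  \<open>E n\<close> and to \<open>A\<close>. Tonelli swaps the integrals there; afterwards the
  cut-offs are dropped, which is why only an inequality results.\<close>

lemma nn_integral_Tonelli_le:
  fixes g :: "'t \<times> 's \<Rightarrow> ennreal"
  assumes g: "g \<in> borel_measurable (\<mu> \<Otimes>\<^sub>M \<nu>)"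
    and E: "\<And>n::nat. E n \<in> finite_sets \<mu>" and A: "A \<in> finite_sets \<nu>"
    and le: "AE s in \<nu>. (\<integral>\<^sup>+ t. g (t, s) \<partial>\<mu>) \<le> c s"
  shows "(\<integral>\<^sup>+ t. indicator (\<Union>n. E n) t * (\<integral>\<^sup>+ s. indicator A s * g (t, s) \<partial>\<nu>) \<partial>\<mu>) \<le> (\<integral>\<^sup>+ s. c s \<partial>\<nu>)"
proof -
  let ?U = "\<Union>n. E n"
  have U: "?U \<in> sets \<mu>" using E by (auto simp: finite_sets_def)
  have A': "A \<in> sets \<nu>" using A by (simp add: finite_sets_def)
  define \<mu>' \<nu>' where "\<mu>' = density \<mu> (indicator ?U)" and "\<nu>' = density \<nu> (indicator A)"
  interpret m: sigma_finite_measure \<mu>'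
    unfolding \<mu>'_def by (rule sigma_finite_density_indicator[OF E])
  interpret n: sigma_finite_measure \<nu>'
    using sigma_finite_density_indicator[of "\<lambda>_. A" \<nu>] A by (simp add: \<nu>'_def)
  interpret pair_sigma_finite \<mu>' \<nu>' ..
  have g': "g \<in> borel_measurable (\<mu>' \<Otimes>\<^sub>M \<nu>')" "g \<in> borel_measurable (\<mu> \<Otimes>\<^sub>M \<nu>')"
  proof -
    have "sets (\<mu>' \<Otimes>\<^sub>M \<nu>') = sets (\<mu> \<Otimes>\<^sub>M \<nu>)" "sets (\<mu> \<Otimes>\<^sub>M \<nu>') = sets (\<mu> \<Otimes>\<^sub>M \<nu>)"
      by (intro sets_pair_measure_cong; simp add: \<mu>'_def \<nu>'_def)+
    from this[THEN measurable_cong_sets, OF refl] g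
    show "g \<in> borel_measurable (\<mu>' \<Otimes>\<^sub>M \<nu>')" "g \<in> borel_measurable (\<mu> \<Otimes>\<^sub>M \<nu>')" by auto
  qed
  have "(\<integral>\<^sup>+ t. indicator ?U t * (\<integral>\<^sup>+ s. indicator A s * g (t, s) \<partial>\<nu>) \<partial>\<mu>)
      = (\<integral>\<^sup>+ t. indicator ?U t * (\<integral>\<^sup>+ s. g (t, s) \<partial>\<nu>') \<partial>\<mu>)"
  proof (intro nn_integral_cong)
    fix t assume "t \<in> space \<mu>"
    then have "(\<lambda>s. g (t, s)) \<in> borel_measurable \<nu>" using g by (rule measurable_compose_Pair1)
    then have "(\<integral>\<^sup>+ s. g (t, s) \<partial>\<nu>') = (\<integral>\<^sup>+ s. indicator A s * g (t, s) \<partial>\<nu>)"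
      unfolding \<nu>'_def using A' by (intro nn_integral_density) auto
    then show "indicator ?U t * (\<integral>\<^sup>+ s. indicator A s * g (t, s) \<partial>\<nu>) = indicator ?U t * (\<integral>\<^sup>+ s. g (t, s) \<partial>\<nu>')"
      by simp
  qed
  also have "\<dots> = (\<integral>\<^sup>+ t. \<integral>\<^sup>+ s. g (t, s) \<partial>\<nu>' \<partial>\<mu>')"
    unfolding \<mu>'_def using U
    by (intro nn_integral_density[symmetric] n.borel_measurable_nn_integral_fst g') auto
  also have "\<dots> = (\<integral>\<^sup>+ s. \<integral>\<^sup>+ t. g (t, s) \<partial>\<mu>' \<partial>\<nu>')"
    using nn_integral_snd[OF g'(1)] n.nn_integral_fst[OF g'(1)] by simp
  also have "\<dots> = (\<integral>\<^sup>+ s. indicator A s * (\<integral>\<^sup>+ t. g (t, s) \<partial>\<mu>') \<partial>\<nu>)"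
  proof -
    have "(\<lambda>s. \<integral>\<^sup>+ t. g (t, s) \<partial>\<mu>') \<in> borel_measurable \<nu>'"
      using m.borel_measurable_nn_integral_fst[OF measurable_pair_swap[OF g'(1)]] by simp
    then have "(\<lambda>s. \<integral>\<^sup>+ t. g (t, s) \<partial>\<mu>') \<in> borel_measurable \<nu>" by (simp add: \<nu>'_def)
    then show ?thesis using A' by (subst \<nu>'_def, intro nn_integral_density) auto
  qed
  also have "\<dots> \<le> (\<integral>\<^sup>+ s. c s \<partial>\<nu>)"
    using le AE_space[of \<nu>]
  proof (intro nn_integral_mono_AE, eventually_elim)
    case (elim s)
    then have gm: "(\<lambda>t. g (t, s)) \<in> borel_measurable \<mu>" by (intro measurable_Pair1[OF g])
    have "(\<integral>\<^sup>+ t. g (t, s) \<partial>\<mu>') = (\<integral>\<^sup>+ t. indicator ?U t * g (t, s) \<partial>\<mu>)"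
      unfolding \<mu>'_def using U gm by (intro nn_integral_density) auto
    also have "\<dots> \<le> (\<integral>\<^sup>+ t. g (t, s) \<partial>\<mu>)" by (intro nn_integral_mono) (auto simp: indicator_def)
    also have "\<dots> \<le> c s" by (rule elim)
    finally show ?case by (auto simp: indicator_def)
  qed
  finally show ?thesis .
qed

subsection \<open>Extension by density\<close>

lemma Lp_funs_add:
  assumes "p \<ge> 1" "f \<in> Lp_funs M p" "g \<in> Lp_funs M p"
  shows "(\<lambda>s. f s + g s) \<in> Lp_funs M p"
proof -
  have "Lp_norm M p (\<lambda>s. f s + g s) \<le> Lp_norm M p f + Lp_norm M p g"
    using assms by (intro Lp_norm_add_le) (auto simp: Lp_funs_def)
  also have "\<dots> < \<infinity>" using assms by (auto simp: Lp_funs_def)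
  finally show ?thesis using assms by (auto simp: Lp_funs_def intro: strongly_measurable_add)
qed

lemma Lp_norm_scaleC_le:
  assumes "p > 0" "strongly_measurable M f"
  shows "Lp_norm M p (\<lambda>s. a *\<^sub>C f s) \<le> ennreal (cmod a) * Lp_norm M p f"
  using assms by (intro Lp_norm_le_mult) (auto simp: norm_scaleC)

lemma Lp_funs_scaleC:
  assumes "p > 0" "f \<in> Lp_funs M p"
  shows "(\<lambda>s. a *\<^sub>C f s) \<in> Lp_funs M p"
proof -
  have "Lp_norm M p (\<lambda>s. a *\<^sub>C f s) \<le> ennreal (cmod a) * Lp_norm M p f"
    using assms by (intro Lp_norm_scaleC_le) (auto simp: Lp_funs_def)
  also have "\<dots> < \<infinity>" using assms by (auto simp: Lp_funs_def ennreal_mult_less_top)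
  finally show ?thesis
    using assms by (auto simp: Lp_funs_def intro: strongly_measurable_bounded_linear[OF bounded_linear_scaleC])
qed

lemma scaleC_minus_one: "(- 1) *\<^sub>C x = - (x :: 'a :: complex_normed_vector)"
  using scaleC_of_real[of "- 1" x] by simp

lemma simple_funs_scaleC:
  "f \<in> simple_funs M \<Longrightarrow> (\<lambda>s. a *\<^sub>C f s) \<in> simple_funs M"
  using simple_funs_compose[of f M "\<lambda>x. a *\<^sub>C x"] norm_scaleC[of a "0 :: 'b"] by simp

section \<open>The closed graph of a bounded operator on simple functions\<close>

text \<open>The sequential closure, in L_q times L_p, of the graph of \<open>K0\<close> over the
  simple functions. Kept as a relation, it can be shown to be linear, bounded, single-valued almost
  everywhere and total before any extension is chosen.\<close>

definition Lp_closure_graph ::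
    "'s measure \<Rightarrow> real \<Rightarrow> 't measure \<Rightarrow> real \<Rightarrow>
     (('s \<Rightarrow> 'x :: complex_banach) \<Rightarrow> ('t \<Rightarrow> 'y :: complex_banach)) \<Rightarrow>
     ('s \<Rightarrow> 'x) \<Rightarrow> ('t \<Rightarrow> 'y) \<Rightarrow> bool" where
  "Lp_closure_graph M q N p K0 f g \<longleftrightarrow> f \<in> Lp_funs M q \<and> g \<in> Lp_funs N p \<and>
     (\<exists>\<phi>. (\<forall>n. \<phi> n \<in> simple_funs M) \<and> (\<lambda>n. Lp_norm M q (\<lambda>s. \<phi> n s - f s)) \<longlonglongrightarrow> 0 \<and>
        (\<lambda>n. Lp_norm N p (\<lambda>t. K0 (\<phi> n) t - g t)) \<longlonglongrightarrow> 0)"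

text \<open>Linearity of \<open>K0\<close> is asked only almost everywhere, since an integral
  operator may be meaningless on a null set that depends on the function.\<close>

locale Lp_bounded_on_simple =
  fixes M :: "'s measure" and N :: "'t measure" and p q C :: real
    and K0 :: "('s \<Rightarrow> 'x :: complex_banach) \<Rightarrow> ('t \<Rightarrow> 'y :: complex_banach)"
  assumes p: "p \<ge> 1" and q: "q \<ge> 1" and C: "C \<ge> 0"
    and K0_measurable: "f \<in> simple_funs M \<Longrightarrow> strongly_measurable N (K0 f)"
    and K0_add: "f \<in> simple_funs M \<Longrightarrow> g \<in> simple_funs M \<Longrightarrow>
      AE t in N. K0 (\<lambda>s. f s + g s) t = K0 f t + K0 g t"
    and K0_scaleC: "f \<in> simple_funs M \<Longrightarrow> AE t in N. K0 (\<lambda>s. a *\<^sub>C f s) t = a *\<^sub>C K0 f t"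
    and K0_bound: "f \<in> simple_funs M \<Longrightarrow> Lp_norm N p (K0 f) \<le> ennreal C * Lp_norm M q f"
begin

abbreviation graph where "graph \<equiv> Lp_closure_graph M q N p K0"

lemma K0_diff:
  assumes "f \<in> simple_funs M" "g \<in> simple_funs M"
  shows "AE t in N. K0 (\<lambda>s. f s - g s) t = K0 f t - K0 g t"
  using K0_add[OF assms(1) simple_funs_scaleC[OF assms(2)], of "- 1"] K0_scaleC[OF assms(2), of "- 1"]
  by eventually_elim (simp add: scaleC_minus_one)

lemma K0_Lp: "f \<in> simple_funs M \<Longrightarrow> K0 f \<in> Lp_funs N p"
  using K0_bound[of f] K0_measurable[of f] simple_funs_Lp[of q f M] q
  by (auto simp: Lp_funs_def ennreal_mult_less_top intro: le_less_trans)

lemma graph_bound: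
  assumes "graph f g"
  shows "Lp_norm N p g \<le> ennreal C * Lp_norm M q f"
proof -
  obtain \<phi> where f: "f \<in> Lp_funs M q" and g: "g \<in> Lp_funs N p" and \<phi>: "\<And>n. \<phi> n \<in> simple_funs M"
    and lim: "(\<lambda>n. Lp_norm M q (\<lambda>s. \<phi> n s - f s)) \<longlonglongrightarrow> 0" "(\<lambda>n. Lp_norm N p (\<lambda>t. K0 (\<phi> n) t - g t)) \<longlonglongrightarrow> 0"
    using assms unfolding Lp_closure_graph_def by blast
  have fm: "strongly_measurable M f" and gm: "strongly_measurable N g" using f g by (auto simp: Lp_funs_def)
  have "Lp_norm N p g \<le> Lp_norm N p (\<lambda>t. K0 (\<phi> n) t - g t) +
      ennreal C * (Lp_norm M q (\<lambda>s. \<phi> n s - f s) + Lp_norm M q f)" for n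
  proof -
    have "Lp_norm N p g \<le> Lp_norm N p (\<lambda>t. g t - K0 (\<phi> n) t) + Lp_norm N p (K0 (\<phi> n))"
      by (intro Lp_norm_le_diff_add p gm K0_measurable \<phi>)
    also have "Lp_norm N p (K0 (\<phi> n)) \<le> ennreal C * Lp_norm M q (\<phi> n)"
      by (intro K0_bound \<phi>)
    also have "Lp_norm M q (\<phi> n) \<le> Lp_norm M q (\<lambda>s. \<phi> n s - f s) + Lp_norm M q f"
      by (intro Lp_norm_le_diff_add q fm strongly_measurable_simple \<phi>)
    finally show ?thesis by (simp add: Lp_norm_minus_commute[of N p g] mult_left_mono add_left_mono)
  qed
  moreover have "(\<lambda>n. Lp_norm N p (\<lambda>t. K0 (\<phi> n) t - g t) +
      ennreal C * (Lp_norm M q (\<lambda>s. \<phi> n s - f s) + Lp_norm M q f)) \<longlonglongrightarrow> 0 + ennreal C * (0 + Lp_norm M q f)"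
    by (intro tendsto_add lim ennreal_tendsto_cmult tendsto_const) auto
  ultimately show ?thesis
    using LIMSEQ_le_const by (metis (no_types, lifting) add_0)
qed

lemma graph_add:
  assumes "graph f g" "graph f' g'"
  shows "graph (\<lambda>s. f s + f' s) (\<lambda>t. g t + g' t)"
proof -
  obtain \<phi> where f: "f \<in> Lp_funs M q" and g: "g \<in> Lp_funs N p" and \<phi>: "\<And>n. \<phi> n \<in> simple_funs M"
    and lim: "(\<lambda>n. Lp_norm M q (\<lambda>s. \<phi> n s - f s)) \<longlonglongrightarrow> 0" "(\<lambda>n. Lp_norm N p (\<lambda>t. K0 (\<phi> n) t - g t)) \<longlonglongrightarrow> 0"
    using assms(1) unfolding Lp_closure_graph_def by blast
  obtain \<phi>' where f': "f' \<in> Lp_funs M q" and g': "g' \<in> Lp_funs N p" and \<phi>': "\<And>n. \<phi>' n \<in> simple_funs M"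
    and lim': "(\<lambda>n. Lp_norm M q (\<lambda>s. \<phi>' n s - f' s)) \<longlonglongrightarrow> 0" "(\<lambda>n. Lp_norm N p (\<lambda>t. K0 (\<phi>' n) t - g' t)) \<longlonglongrightarrow> 0"
    using assms(2) unfolding Lp_closure_graph_def by blast
  note sm = f[unfolded Lp_funs_def] f'[unfolded Lp_funs_def] g[unfolded Lp_funs_def] g'[unfolded Lp_funs_def]
  have 1: "Lp_norm M q (\<lambda>s. (\<phi> n s + \<phi>' n s) - (f s + f' s)) \<le>
      Lp_norm M q (\<lambda>s. \<phi> n s - f s) + Lp_norm M q (\<lambda>s. \<phi>' n s - f' s)" for n
    using Lp_norm_add_le[OF q strongly_measurable_diff[OF strongly_measurable_simple[OF \<phi>[of n]], of f]
        strongly_measurable_diff[OF strongly_measurable_simple[OF \<phi>'[of n]], of f']] sm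
    by (simp add: add_diff_add)
  have 2: "Lp_norm N p (\<lambda>t. K0 (\<lambda>s. \<phi> n s + \<phi>' n s) t - (g t + g' t)) \<le>
      Lp_norm N p (\<lambda>t. K0 (\<phi> n) t - g t) + Lp_norm N p (\<lambda>t. K0 (\<phi>' n) t - g' t)" for n
  proof -
    have "Lp_norm N p (\<lambda>t. K0 (\<lambda>s. \<phi> n s + \<phi>' n s) t - (g t + g' t)) =
      Lp_norm N p (\<lambda>t. (K0 (\<phi> n) t - g t) + (K0 (\<phi>' n) t - g' t))"
      using K0_add[OF \<phi>[of n] \<phi>'[of n]] by (intro Lp_norm_cong_AE) (auto elim!: eventually_mono simp: add_diff_add)
    also have "\<dots> \<le> Lp_norm N p (\<lambda>t. K0 (\<phi> n) t - g t) + Lp_norm N p (\<lambda>t. K0 (\<phi>' n) t - g' t)"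
      using sm by (intro Lp_norm_add_le p strongly_measurable_diff K0_measurable \<phi> \<phi>') auto
    finally show ?thesis .
  qed
  show ?thesis
    unfolding Lp_closure_graph_def
  proof (intro conjI exI[of _ "\<lambda>n s. \<phi> n s + \<phi>' n s"] allI)
    show "(\<lambda>n. Lp_norm M q (\<lambda>s. (\<phi> n s + \<phi>' n s) - (f s + f' s))) \<longlonglongrightarrow> 0"
      using ennreal_tendsto_0_le[OF 1] tendsto_add[OF lim(1) lim'(1)] by simp
    show "(\<lambda>n. Lp_norm N p (\<lambda>t. K0 (\<lambda>s. \<phi> n s + \<phi>' n s) t - (g t + g' t))) \<longlonglongrightarrow> 0"
      using ennreal_tendsto_0_le[OF 2] tendsto_add[OF lim(2) lim'(2)] by simp
  qed (auto intro: simple_funs_add \<phi> \<phi>' Lp_funs_add p q f f' g g')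
qed

lemma graph_scaleC:
  assumes "graph f g"
  shows "graph (\<lambda>s. a *\<^sub>C f s) (\<lambda>t. a *\<^sub>C g t)"
proof -
  obtain \<phi> where f: "f \<in> Lp_funs M q" and g: "g \<in> Lp_funs N p" and \<phi>: "\<And>n. \<phi> n \<in> simple_funs M"
    and lim: "(\<lambda>n. Lp_norm M q (\<lambda>s. \<phi> n s - f s)) \<longlonglongrightarrow> 0" "(\<lambda>n. Lp_norm N p (\<lambda>t. K0 (\<phi> n) t - g t)) \<longlonglongrightarrow> 0"
    using assms(1) unfolding Lp_closure_graph_def by blast
  have diff: "a *\<^sub>C x - a *\<^sub>C y = a *\<^sub>C (x - y)" for x y :: "'z :: complex_normed_vector"
    by (simp add: linear_diff[OF bounded_linear.linear[OF bounded_linear_scaleC]])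
  have 1: "Lp_norm M q (\<lambda>s. a *\<^sub>C \<phi> n s - a *\<^sub>C f s) \<le> ennreal (cmod a) * Lp_norm M q (\<lambda>s. \<phi> n s - f s)" for n
    unfolding diff using f q strongly_measurable_simple[OF \<phi>]
    by (intro Lp_norm_scaleC_le strongly_measurable_diff) (auto simp: Lp_funs_def)
  have 2: "Lp_norm N p (\<lambda>t. K0 (\<lambda>s. a *\<^sub>C \<phi> n s) t - a *\<^sub>C g t) \<le> ennreal (cmod a) * Lp_norm N p (\<lambda>t. K0 (\<phi> n) t - g t)" for n
  proof -
    have "Lp_norm N p (\<lambda>t. K0 (\<lambda>s. a *\<^sub>C \<phi> n s) t - a *\<^sub>C g t) = Lp_norm N p (\<lambda>t. a *\<^sub>C (K0 (\<phi> n) t - g t))"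
      using K0_scaleC[OF \<phi>[of n], of a] by (intro Lp_norm_cong_AE) (auto elim!: eventually_mono simp: diff)
    also have "\<dots> \<le> ennreal (cmod a) * Lp_norm N p (\<lambda>t. K0 (\<phi> n) t - g t)"
      using g p by (intro Lp_norm_scaleC_le strongly_measurable_diff K0_measurable \<phi>) (auto simp: Lp_funs_def)
    finally show ?thesis .
  qed
  have cm: "(\<lambda>n. ennreal (cmod a) * u n) \<longlonglongrightarrow> 0" if "u \<longlonglongrightarrow> 0" for u :: "nat \<Rightarrow> ennreal"
    using ennreal_tendsto_cmult[OF _ that, of "ennreal (cmod a)"] by simp
  show ?thesis
    unfolding Lp_closure_graph_def
  proof (intro conjI exI[of _ "\<lambda>n s. a *\<^sub>C \<phi> n s"] allI)
    show "(\<lambda>n. Lp_norm M q (\<lambda>s. a *\<^sub>C \<phi> n s - a *\<^sub>C f s)) \<longlonglongrightarrow> 0"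
      by (rule ennreal_tendsto_0_le[OF 1 cm[OF lim(1)]])
    show "(\<lambda>n. Lp_norm N p (\<lambda>t. K0 (\<lambda>s. a *\<^sub>C \<phi> n s) t - a *\<^sub>C g t)) \<longlonglongrightarrow> 0"
      by (rule ennreal_tendsto_0_le[OF 2 cm[OF lim(2)]])
  qed (use p q in \<open>auto intro: simple_funs_scaleC \<phi> Lp_funs_scaleC f g\<close>)
qed

text \<open>The difference of the two pairs lies in the graph over a function of norm 0, so the
  bound makes its second component 0 almost everywhere. Applied to sums and multiples of graph
  pairs, this gives the linearity of any selection.\<close>

lemma graph_unique:
  assumes "graph f g" "graph f' g'" "AE s in M. f s = f' s"
  shows "AE t in N. g t = g' t"
proof -
  have d: "graph (\<lambda>s. f s + (- 1) *\<^sub>C f' s) (\<lambda>t. g t + (- 1) *\<^sub>C g' t)"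
    by (intro graph_add graph_scaleC assms)
  have "Lp_norm M q (\<lambda>s. f s + (- 1) *\<^sub>C f' s) = Lp_norm M q (\<lambda>s. 0 :: 'x)"
    using assms(3) by (intro Lp_norm_cong_AE) (auto elim!: eventually_mono simp: scaleC_minus_one)
  then have "Lp_norm N p (\<lambda>t. g t + (- 1) *\<^sub>C g' t) = 0"
    using graph_bound[OF d] q by (simp add: Lp_norm_zero)
  then have "AE t in N. g t + (- 1) *\<^sub>C g' t = 0"
    using d p by (intro Lp_norm_eq_0_AE) (auto simp: Lp_closure_graph_def Lp_funs_def)
  then show ?thesis by eventually_elim (simp add: scaleC_minus_one)
qed

lemma graph_simple:
  assumes "f \<in> simple_funs M"
  shows "graph f (K0 f)"
  unfolding Lp_closure_graph_def using assms p q
  by (intro conjI exI[of _ "\<lambda>_. f"]) (auto intro: simple_funs_Lp K0_Lp simp: Lp_norm_zero)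

text \<open>Approximating \<open>f\<close> at the rate 4^(-n) makes the images under
  \<open>K0\<close> rapidly Cauchy; the limit of the images is a partner for
  \<open>f\<close>.\<close>

lemma graph_total:
  assumes f: "f \<in> Lp_funs M q"
  shows "\<exists>g. graph f g"
proof -
  have fm: "strongly_measurable M f" using f by (simp add: Lp_funs_def)
  have "\<exists>\<phi>\<in>simple_funs M. Lp_norm M q (\<lambda>s. \<phi> s - f s) \<le> ennreal ((1/4)^n)" for n :: nat
    using q by (intro simple_funs_dense f) auto
  then obtain \<phi> where \<phi>: "\<And>n. \<phi> n \<in> simple_funs M"
    and \<phi>_le: "\<And>n. Lp_norm M q (\<lambda>s. \<phi> n s - f s) \<le> ennreal ((1/4)^n)" by metis
  \<comment> \<open>The images \<open>K0 (\<phi> n)\<close> need not be simple, as the completeness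
    lemma demands, so they are replaced by simple functions at the same rate.\<close>
  have "\<exists>\<psi>\<in>simple_funs N. Lp_norm N p (\<lambda>t. \<psi> t - K0 (\<phi> n) t) \<le> ennreal ((1/4)^n)" for n :: nat
    using p by (intro simple_funs_dense K0_Lp \<phi>) auto
  then obtain \<psi> where \<psi>: "\<And>n. \<psi> n \<in> simple_funs N"
    and \<psi>_le: "\<And>n. Lp_norm N p (\<lambda>t. \<psi> n t - K0 (\<phi> n) t) \<le> ennreal ((1/4)^n)" by metis
  note sm\<phi> = strongly_measurable_simple[OF \<phi>] and sm\<psi> = strongly_measurable_simple[OF \<psi>]
    and smK = K0_measurable[OF \<phi>]
  have pos: "0 \<le> (1/4::real)^n" "(1/4::real)^Suc n \<le> (1/4)^n" for n by auto
  have K_le: "Lp_norm N p (\<lambda>t. K0 (\<phi> n) t - K0 (\<phi> (Suc n)) t) \<le> ennreal (2 * C * (1/4)^n)" for n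
  proof -
    have "Lp_norm N p (\<lambda>t. K0 (\<phi> n) t - K0 (\<phi> (Suc n)) t) = Lp_norm N p (K0 (\<lambda>s. \<phi> n s - \<phi> (Suc n) s))"
      using K0_diff[OF \<phi>[of n] \<phi>[of "Suc n"]] by (intro Lp_norm_cong_AE) (auto elim!: eventually_mono)
    also have "\<dots> \<le> ennreal C * Lp_norm M q (\<lambda>s. \<phi> n s - \<phi> (Suc n) s)"
      by (intro K0_bound simple_funs_diff \<phi>)
    also have "\<dots> \<le> ennreal C * (Lp_norm M q (\<lambda>s. \<phi> n s - f s) + Lp_norm M q (\<lambda>s. f s - \<phi> (Suc n) s))"
      by (intro mult_left_mono Lp_norm_diff_triangle q fm sm\<phi>) auto
    also have "\<dots> \<le> ennreal C * (ennreal ((1/4)^n) + ennreal ((1/4)^n))"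
      using \<phi>_le[of n] \<phi>_le[of "Suc n"] order_trans[OF \<phi>_le[of "Suc n"] ennreal_leI[OF pos(2)]]
      by (intro mult_left_mono add_mono) (simp_all add: Lp_norm_minus_commute[of M q f])
    also have "\<dots> = ennreal (2 * C * (1/4)^n)"
      using C pos(1)[of n] by (simp flip: ennreal_plus ennreal_mult add: algebra_simps)
    finally show ?thesis .
  qed
  \<comment> \<open>The part 2 C comes from the images of two consecutive \<open>\<phi>\<close>, the
    summand 2 from replacing both images by \<open>\<psi>\<close>.\<close>
  have "Lp_norm N p (\<lambda>t. \<psi> n t - \<psi> (Suc n) t) \<le> ennreal ((2 * C + 2) * (1/4)^n)" for n
  proof -
    have "Lp_norm N p (\<lambda>t. \<psi> n t - \<psi> (Suc n) t) \<le> Lp_norm N p (\<lambda>t. \<psi> n t - K0 (\<phi> n) t) +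
        Lp_norm N p (\<lambda>t. K0 (\<phi> n) t - \<psi> (Suc n) t)"
      by (intro Lp_norm_diff_triangle p sm\<psi> smK)
    also have "Lp_norm N p (\<lambda>t. K0 (\<phi> n) t - \<psi> (Suc n) t) \<le> Lp_norm N p (\<lambda>t. K0 (\<phi> n) t - K0 (\<phi> (Suc n)) t)
        + Lp_norm N p (\<lambda>t. K0 (\<phi> (Suc n)) t - \<psi> (Suc n) t)"
      by (intro Lp_norm_diff_triangle p sm\<psi> smK)
    also have "Lp_norm N p (\<lambda>t. K0 (\<phi> (Suc n)) t - \<psi> (Suc n) t) \<le> ennreal ((1/4)^n)"
      using order_trans[OF \<psi>_le[of "Suc n"] ennreal_leI[OF pos(2)]]
      by (simp add: Lp_norm_minus_commute[of N p "K0 (\<phi> (Suc n))"])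
    also note K_le[of n]
    also note \<psi>_le[of n]
    finally have "Lp_norm N p (\<lambda>t. \<psi> n t - \<psi> (Suc n) t) \<le>
        ennreal ((1/4)^n) + (ennreal (2 * C * (1/4)^n) + ennreal ((1/4)^n))"
      by (simp add: add_mono)
    also have "\<dots> = ennreal ((2 * C + 2) * (1/4)^n)"
      using C by (simp flip: ennreal_plus add: algebra_simps)
    finally show ?thesis .
  qed
  then obtain g where g: "g \<in> Lp_funs N p" and lim: "(\<lambda>n. Lp_norm N p (\<lambda>t. \<psi> n t - g t)) \<longlonglongrightarrow> 0"
    using Lp_rapidly_Cauchy_converges[of p "2 * C + 2" \<psi> N] p \<psi> C by auto
  have q4: "(\<lambda>n. ennreal ((1/4)^n)) \<longlonglongrightarrow> 0"
    using tendsto_ennrealI[OF LIMSEQ_power_zero[of "1/4 :: real"]] by simp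
  have Kg_le: "Lp_norm N p (\<lambda>t. K0 (\<phi> n) t - g t) \<le> ennreal ((1/4)^n) + Lp_norm N p (\<lambda>t. \<psi> n t - g t)" for n
  proof -
    have "Lp_norm N p (\<lambda>t. K0 (\<phi> n) t - g t) \<le>
        Lp_norm N p (\<lambda>t. K0 (\<phi> n) t - \<psi> n t) + Lp_norm N p (\<lambda>t. \<psi> n t - g t)"
      using g by (intro Lp_norm_diff_triangle p sm\<psi> smK) (auto simp: Lp_funs_def)
    also have "Lp_norm N p (\<lambda>t. K0 (\<phi> n) t - \<psi> n t) \<le> ennreal ((1/4)^n)"
      using \<psi>_le[of n] by (simp add: Lp_norm_minus_commute[of N p "K0 (\<phi> n)"])
    finally show ?thesis by simp
  qed
  have "(\<lambda>n. Lp_norm N p (\<lambda>t. K0 (\<phi> n) t - g t)) \<longlonglongrightarrow> 0"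
    using ennreal_tendsto_0_le[OF Kg_le] tendsto_add[OF q4 lim] by simp
  moreover have "(\<lambda>n. Lp_norm M q (\<lambda>s. \<phi> n s - f s)) \<longlonglongrightarrow> 0"
    by (rule ennreal_tendsto_0_le[OF \<phi>_le q4])
  ultimately have "graph f g" unfolding Lp_closure_graph_def using \<phi> f g by blast
  then show ?thesis by blast
qed

theorem extension:
  "\<exists>K. bounded_Lp_operator M q N p K \<and> (\<forall>f\<in>simple_funs M. AE t in N. K f t = K0 f t) \<and>
     Lp_operator_norm M q N p K \<le> ennreal C"
proof -
  \<comment> \<open>Any choice will do: the graph fixes the value up to a null set, and linearity of
    an operator is demanded only up to null sets.\<close>
  define K where "K f = (SOME g. graph f g)" for f
  have K: "graph f (K f)" if "f \<in> Lp_funs M q" for f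
    unfolding K_def using graph_total[OF that] by (rule someI_ex)
  have bound: "Lp_norm N p (K f) \<le> ennreal C * Lp_norm M q f" if "f \<in> Lp_funs M q" for f
    by (rule graph_bound[OF K[OF that]])
  have "bounded_Lp_operator M q N p K"
    unfolding bounded_Lp_operator_def
  proof (intro conjI ballI allI impI exI[of _ C])
    show "K f \<in> Lp_funs N p" if "f \<in> Lp_funs M q" for f
      using K[OF that] by (simp add: Lp_closure_graph_def)
    show "AE t in N. K f t = K g t" if "f \<in> Lp_funs M q" "g \<in> Lp_funs M q" "AE s in M. f s = g s" for f g
      by (rule graph_unique[OF K[OF that(1)] K[OF that(2)] that(3)])
    show "AE t in N. K (\<lambda>s. f s + g s) t = K f t + K g t" if "f \<in> Lp_funs M q" "g \<in> Lp_funs M q" for f g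
      by (rule graph_unique[OF K[OF Lp_funs_add[OF q that]] graph_add[OF K[OF that(1)] K[OF that(2)]]]) simp
    show "AE t in N. K (\<lambda>s. a *\<^sub>C f s) t = a *\<^sub>C K f t" if "f \<in> Lp_funs M q" for a f
      using q by (intro graph_unique[OF K[OF Lp_funs_scaleC] graph_scaleC[OF K]] that) auto
  qed (rule bound)
  moreover have "AE t in N. K f t = K0 f t" if "f \<in> simple_funs M" for f
    using graph_unique[OF K graph_simple[OF that]] simple_funs_Lp[OF _ that, of q] q by simp
  moreover have "Lp_operator_norm M q N p K \<le> ennreal C"
    unfolding Lp_operator_norm_def
  proof (rule SUP_least)
    fix f :: "'s \<Rightarrow> 'x" assume "f \<in> {f \<in> Lp_funs M q. Lp_norm M q f \<le> 1}"
    then show "Lp_norm N p (K f) \<le> ennreal C"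
      using order_trans[OF bound[of f], of "ennreal C"] mult_left_mono[of "Lp_norm M q f" 1 "ennreal C"] by simp
  qed
  ultimately show ?thesis by blast
qed

end

subsection \<open>The integral operator\<close>

lemma AE_full_sets: "T' \<in> full_sets M \<Longrightarrow> AE t in M. t \<in> T'"
  by (intro AE_I[of _ _ "space M - T'"]) (auto simp: full_sets_def)

lemma scaleC_zero: "a *\<^sub>C (0 :: 'a :: complex_normed_vector) = 0"
  using norm_scaleC[of a "0 :: 'a"] by simp

section \<open>The weight that splits a simple function\<close>

text \<open>With u = |f(s)|, the two multiples of f(s) carry the factors \<delta>(u) u^(q(1 -
  1/\<theta>) - 1) and \<delta>(u) u^(q-1), and the equation says that they recombine to f(s).
  Solving for \<delta> gives u^(q/p) / D(u), and \<delta> \<le> 1 is the weighted AM-GM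
  inequality.\<close>

lemma interpolation_weight_exists:
  fixes \<sigma> \<theta> p q :: real
  assumes \<sigma>: "\<sigma> > 0" and \<theta>: "\<theta> \<ge> 1" and p: "p \<ge> \<theta>" and q: "q \<ge> 1" and pq: "1 / q - 1 / p = 1 - 1 / \<theta>"
  shows "\<exists>\<delta> :: real \<Rightarrow> real. (\<forall>u. 0 \<le> \<delta> u \<and> \<delta> u \<le> 1) \<and>
    (\<forall>u>0. (1 - \<theta> / p) * \<sigma> powr (\<theta> / p) * (\<delta> u * u powr (q * (1 - 1 / \<theta>) - 1))
        + \<theta> / p * \<sigma> powr (\<theta> / p - 1) * (\<delta> u * u powr (q - 1)) = 1)"
proof -
  define l where "l = \<theta> / p"
  have l: "0 < l" "l \<le> 1" using \<theta> p by (auto simp: l_def)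
  \<comment> \<open>What remains of the two coefficients when the common power u^(q(1 - 1/\<theta>)
    - 1) is taken out.\<close>
  define D where "D u = (1 - l) * \<sigma> powr l + l * \<sigma> powr (l - 1) * u powr (q / \<theta>)" for u
  define \<delta> where "\<delta> u = u powr (q / p) / D u" for u
  have le: "u powr (q / p) \<le> D u" for u
  proof -
    have "(u powr (q / \<theta>) / \<sigma>) powr l \<le> (1 - l) * 1 + l * (u powr (q / \<theta>) / \<sigma>)"
      using weighted_arith_geo_mean[of l 1 "u powr (q / \<theta>) / \<sigma>"] l \<sigma> by simp
    then have "\<sigma> powr l * (u powr (q / \<theta>) / \<sigma>) powr l \<le> \<sigma> powr l * ((1 - l) * 1 + l * (u powr (q / \<theta>) / \<sigma>))"
      by (intro mult_left_mono) auto
    also have "\<sigma> powr l * (u powr (q / \<theta>) / \<sigma>) powr l = u powr (q / p)"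
      using \<sigma> \<theta> by (simp add: powr_divide powr_powr l_def)
    also have "\<sigma> powr l * ((1 - l) * 1 + l * (u powr (q / \<theta>) / \<sigma>)) = D u"
      using \<sigma> by (simp add: D_def powr_diff algebra_simps)
    finally show ?thesis .
  qed
  have D0: "D u \<ge> 0" for u using l by (auto simp: D_def intro!: add_nonneg_nonneg mult_nonneg_nonneg)
  have "(1 - l) * \<sigma> powr l * (\<delta> u * u powr (q * (1 - 1 / \<theta>) - 1)) + l * \<sigma> powr (l - 1) * (\<delta> u * u powr (q - 1)) = 1"
    if u: "u > 0" for u
  proof -
    have D: "D u > 0" using le[of u] u by (auto intro: less_le_trans[of _ "u powr (q / p)"])
    define e where "e = q * (1 - 1 / \<theta>) - 1"
    have "q - 1 = e + q / \<theta>" using \<theta> by (simp add: e_def field_simps)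
    then have "u powr (q - 1) = u powr e * u powr (q / \<theta>)" by (simp add: powr_add)
    then have "(1 - l) * \<sigma> powr l * (\<delta> u * u powr e) + l * \<sigma> powr (l - 1) * (\<delta> u * u powr (q - 1))
        = \<delta> u * u powr e * D u"
      by (simp add: D_def algebra_simps)
    also have "\<dots> = u powr (q / p) * u powr e" using D by (simp add: \<delta>_def)
    also have "\<dots> = u powr (q / p + e)" by (simp add: powr_add)
    \<comment> \<open>Here the relation between the exponents enters: the bracket equals 1 / q, so
      the power of \<open>u\<close> cancels.\<close>
    also have "q / p + e = q * (1 / p + (1 - 1 / \<theta>)) - 1" by (simp add: e_def algebra_simps)
    also have "\<dots> = 0" unfolding pq[symmetric] using q by simp
    finally show ?thesis using u by (simp add: e_def)
  qed
  moreover have "0 \<le> \<delta> u \<and> \<delta> u \<le> 1" for u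
    using le[of u] D0[of u] by (auto simp: \<delta>_def divide_le_eq)
  ultimately show ?thesis unfolding l_def by blast
qed

text \<open>The assumption \<open>p \<ge> \<theta>\<close> is derived from the range of
  \<open>q\<close> in the final proof; it puts the interpolation parameter \<theta> / p into (0,
  1].\<close>

locale operator_kernel =
  fixes \<mu> :: "'t measure" and \<nu> :: "'s measure"
    and k :: "'t \<Rightarrow> 's \<Rightarrow> 'x :: complex_banach \<Rightarrow>\<^sub>L 'y :: complex_banach"
    and Z :: "('y \<Rightarrow>\<^sub>L complex) set"
    and \<tau> \<theta> p q C1 C2 :: real
  assumes Z: "csubspace Z" and \<tau>: "\<tau> \<ge> 1" and norming: "norms_space \<tau> Z"
    and \<theta>: "\<theta> \<ge> 1" and pq: "1 / q - 1 / p = 1 - 1 / \<theta>" and q: "q \<ge> 1" and p: "p \<ge> \<theta>"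
    and k: "\<And>t s. t \<in> space \<mu> \<Longrightarrow> s \<in> space \<nu> \<Longrightarrow> k t s \<in> bounded_clinear_ops"
    and C1: "C1 \<ge> 0" and C2: "C2 \<ge> 0"
    and condA: "kernel_cond_A \<mu> \<nu> k"
    and condB: "kernel_cond_B \<mu> \<nu> \<theta> C1 k"
    and condC: "kernel_cond_C \<mu> \<nu> \<theta> C2 Z k"
begin

section \<open>The integral operator on simple functions\<close>

definition K0 :: "('s \<Rightarrow> 'x) \<Rightarrow> 't \<Rightarrow> 'y" where
  "K0 f t = vector_bochner_integral \<nu> (\<lambda>s. blinfun_apply (k t s) (f s))"

lemma K0_eq: "has_vector_bochner_integral \<nu> (\<lambda>s. blinfun_apply (k t s) (f s)) I \<Longrightarrow> K0 f t = I"
  unfolding K0_def by (rule vector_bochner_integral_eq)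

text \<open>Condition (A) treats a vector times an indicator. A simple function is a finite sum of
  these, so the exceptional sets still unite to a null set.\<close>

lemma K0_simple:
  assumes "f \<in> simple_funs \<nu>"
  shows "AE t in \<mu>. has_vector_bochner_integral \<nu> (\<lambda>s. blinfun_apply (k t s) (f s)) (K0 f t)" (is ?th1)
    and "strongly_measurable \<mu> (K0 f)" (is ?th2)
proof -
  obtain n :: nat and x A where A: "\<And>i. i < n \<Longrightarrow> A i \<in> finite_sets \<nu>"
    and f: "f = (\<lambda>s. \<Sum>i<n. indicator (A i) s *\<^sub>R x i)"
    using assms unfolding simple_funs_def by blast
  let ?F = "\<lambda>t i s. indicator (A i) s *\<^sub>R blinfun_apply (k t s) (x i)"
  have k_eq: "(\<lambda>s. blinfun_apply (k t s) (f s)) = (\<lambda>s. \<Sum>i<n. ?F t i s)" for t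
    by (simp only: f blinfun.sum_right blinfun.scaleR_right)
  have "AE t in \<mu>. vector_bochner_integrable \<nu> (?F t i)" if i: "i < n" for i
  proof -
    obtain T' where T': "T' \<in> full_sets \<mu>" "\<And>t. t \<in> T' \<Longrightarrow> vector_bochner_integrable \<nu> (?F t i)"
      using condA A[OF i] unfolding kernel_cond_A_def by blast
    show ?thesis using AE_full_sets[OF T'(1)] by eventually_elim (rule T'(2))
  qed
  then have "AE t in \<mu>. \<forall>i\<in>{..<n}. vector_bochner_integrable \<nu> (?F t i)"
    by (intro AE_finite_allI) auto
  then have *: "AE t in \<mu>. has_vector_bochner_integral \<nu> (\<lambda>s. blinfun_apply (k t s) (f s))
      (\<Sum>i<n. vector_bochner_integral \<nu> (?F t i))"
  proof eventually_elim
    case (elim t)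
    show ?case unfolding k_eq
      by (rule has_vector_bochner_integral_sum, rule has_vector_bochner_integral_integral) (use elim in blast)
  qed
  from * have eq: "AE t in \<mu>. (\<Sum>i<n. vector_bochner_integral \<nu> (?F t i)) = K0 f t"
    by eventually_elim (simp add: K0_eq)
  show ?th1 using * eq by eventually_elim simp
  have "strongly_measurable \<mu> (\<lambda>t. \<Sum>i<n. vector_bochner_integral \<nu> (?F t i))"
  proof (rule strongly_measurable_sum)
    fix i assume "i \<in> {..<n}"
    then show "strongly_measurable \<mu> (\<lambda>t. vector_bochner_integral \<nu> (?F t i))"
      using condA A unfolding kernel_cond_A_def by blast
  qed
  then show ?th2 using eq by (rule strongly_measurable_cong_AE)
qed

lemma K0_add:
  assumes "f \<in> simple_funs \<nu>" "g \<in> simple_funs \<nu>"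
  shows "AE t in \<mu>. K0 (\<lambda>s. f s + g s) t = K0 f t + K0 g t"
  using K0_simple(1)[OF assms(1)] K0_simple(1)[OF assms(2)]
proof eventually_elim
  case (elim t)
  show ?case by (rule K0_eq) (use has_vector_bochner_integral_add[OF elim] in \<open>simp add: blinfun.add_right\<close>)
qed

lemma K0_scaleC:
  assumes "f \<in> simple_funs \<nu>"
  shows "AE t in \<mu>. K0 (\<lambda>s. a *\<^sub>C f s) t = a *\<^sub>C K0 f t"
  using K0_simple(1)[OF assms] AE_space
proof eventually_elim
  case (elim t)
  \<comment> \<open>Complex linearity of the kernel is known only on the two spaces; outside
    \<open>space \<nu>\<close> the simple function is 0.\<close>
  have "blinfun_apply (k t s) (a *\<^sub>C f s) = a *\<^sub>C blinfun_apply (k t s) (f s)" for s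
  proof (cases "s \<in> space \<nu>")
    case True
    then show ?thesis using k[OF elim(2)] by (auto simp: bounded_clinear_ops_def)
  next
    case False
    then show ?thesis using assms by (simp add: simple_funs_iff scaleC_zero)
  qed
  then show ?case
    using has_vector_bochner_integral_bounded_linear[OF bounded_linear_scaleC[of a] elim(1)] by (intro K0_eq) simp
qed

section \<open>Estimates from conditions (B) and (C)\<close>

text \<open>Hoelder pairs \<open>g\<close> with the adjoint kernel applied to a functional in
  \<open>Z\<close>, and the norming property turns the scalar bounds into a norm bound. Measuring
  \<open>g\<close> through \<open>w\<close> treats the conjugate exponent of \<theta> uniformly,
  including \<theta> = 1, where it is \<infinity>.\<close>

lemma K0_sup_bound:
  assumes g: "g \<in> simple_funs \<nu>" and w: "w \<in> borel_measurable \<nu>" "\<And>s. w s \<ge> 0"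
    and int: "(\<integral>\<^sup>+ s. ennreal (w s) \<partial>\<nu>) \<le> ennreal \<beta>" and \<beta>: "\<beta> > 0"
    and le: "\<And>s. norm (g s) \<le> w s powr (1 - 1 / \<theta>)"
  shows "AE t in \<mu>. norm (K0 g t) \<le> \<tau> * (\<beta> powr (1 - 1 / \<theta>) * C2)"
proof (rule AE_norm_le_if_norming[OF Z norming _ K0_simple(2)[OF g]])
  fix y' assume y': "y' \<in> Z" "norm y' \<le> 1"
  let ?\<kappa> = "\<lambda>t s. norm (dual_adjoint (k t s) y')"
  obtain T' where T': "T' \<in> full_sets \<mu>"
    and sm: "\<And>t. t \<in> T' \<Longrightarrow> strongly_measurable \<nu> (\<lambda>s. ?\<kappa> t s powr \<theta>)"
    and bd: "\<And>t. t \<in> T' \<Longrightarrow> ennreal_powr (\<integral>\<^sup>+ s. ennreal (?\<kappa> t s powr \<theta>) \<partial>\<nu>) (1 / \<theta>) \<le> ennreal (C2 * norm y')"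
    using condC y' unfolding kernel_cond_C_def by blast
  show "AE t in \<mu>. cmod (blinfun_apply y' (K0 g t)) \<le> \<beta> powr (1 - 1 / \<theta>) * C2"
    using K0_simple(1)[OF g] AE_full_sets[OF T']
  proof eventually_elim
    case (elim t)
    have "(\<integral>\<^sup>+ s. ennreal (?\<kappa> t s powr \<theta>) \<partial>\<nu>) \<le> ennreal ((C2 * norm y') powr \<theta>)"
      using bd[OF elim(2)] \<theta> C2 by (simp add: ennreal_powr_le_iff)
    also have "\<dots> \<le> ennreal (C2 powr \<theta>)"
      using y' C2 \<theta> mult_left_mono[of "norm y'" 1 C2] by (intro ennreal_leI powr_mono2) auto
    finally have \<kappa>: "(\<integral>\<^sup>+ s. ennreal (?\<kappa> t s powr \<theta>) \<partial>completion \<nu>) \<le> ennreal (C2 powr \<theta>)"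
      by (simp add: nn_integral_completion)
    have "ennreal (cmod (blinfun_apply y' (K0 g t)))
        \<le> (\<integral>\<^sup>+ s. ennreal (cmod (blinfun_apply y' (blinfun_apply (k t s) (g s)))) \<partial>\<nu>)"
      by (rule has_vector_bochner_integral_norm_le
          [OF has_vector_bochner_integral_bounded_linear[OF blinfun.bounded_linear_right elim(1)]])
    also have "\<dots> \<le> (\<integral>\<^sup>+ s. ennreal (w s powr (1 - 1 / \<theta>) * (?\<kappa> t s powr \<theta>) powr (1 / \<theta>)) \<partial>\<nu>)"
    proof (intro nn_integral_mono ennreal_leI)
      fix s
      have "cmod (blinfun_apply y' (blinfun_apply (k t s) (g s))) \<le> ?\<kappa> t s * norm (g s)"
        using norm_blinfun[of "dual_adjoint (k t s) y'" "g s"] by (simp add: dual_adjoint_def)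
      also have "\<dots> \<le> ?\<kappa> t s * w s powr (1 - 1 / \<theta>)" by (intro mult_left_mono le) auto
      finally show "cmod (blinfun_apply y' (blinfun_apply (k t s) (g s)))
          \<le> w s powr (1 - 1 / \<theta>) * (?\<kappa> t s powr \<theta>) powr (1 / \<theta>)"
        using \<theta> by (simp add: powr_powr mult.commute)
    qed
    also have "\<dots> = (\<integral>\<^sup>+ s. ennreal (w s powr (1 - 1 / \<theta>) * (?\<kappa> t s powr \<theta>) powr (1 / \<theta>)) \<partial>completion \<nu>)"
      by (simp add: nn_integral_completion)
    also have "\<dots> \<le> ennreal (\<beta> powr (1 - 1 / \<theta>) * (C2 powr \<theta>) powr (1 / \<theta>))"
    proof (rule nn_integral_powr_interpolation)
      show "(\<lambda>s. ?\<kappa> t s powr \<theta>) \<in> borel_measurable (completion \<nu>)"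
        by (rule strongly_measurable_borel_completion[OF sm[OF elim(2)]])
      show "(\<integral>\<^sup>+ s. ennreal (w s) \<partial>completion \<nu>) \<le> ennreal \<beta>" using int by (simp add: nn_integral_completion)
    qed (use \<theta> \<beta> w \<kappa> in \<open>auto intro: measurable_completion\<close>)
    also have "\<dots> = ennreal (\<beta> powr (1 - 1 / \<theta>) * C2)" using \<theta> C2 by (simp add: powr_powr)
    finally show ?case using C2 by simp
  qed
qed (use \<tau> in auto)

text \<open>Interpolation carried out at a single \<open>t\<close>: for each \<sigma> one part of
  \<open>f\<close> is controlled by the uniform bound from (C), the other by \<open>B t\<close>, and
  \<sigma> is optimised only afterwards.\<close>

lemma K0_pointwise_bound:
  assumes f: "f \<in> simple_funs \<nu>" and \<beta>: "\<beta> > 0"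
    and int: "(\<integral>\<^sup>+ s. ennreal (norm (f s) powr q) \<partial>\<nu>) = ennreal \<beta>"
  defines "B \<equiv> \<lambda>t. \<integral>\<^sup>+ s. ennreal (norm (f s) powr (q - 1) * norm (blinfun_apply (k t s) (f s))) \<partial>\<nu>"
  shows "AE t in \<mu>. B t < \<infinity> \<and> norm (K0 f t) \<le>
    real_pow (\<tau> * (\<beta> powr (1 - 1 / \<theta>) * C2)) (1 - \<theta> / p) * enn2real (B t) powr (\<theta> / p)"
proof -
  define A where "A = \<tau> * (\<beta> powr (1 - 1 / \<theta>) * C2)"
  have A: "A \<ge> 0" using \<tau> C2 by (simp add: A_def)
  have l: "0 < \<theta> / p" "\<theta> / p \<le> 1" using \<theta> p by auto
  have wm: "(\<lambda>s. norm (f s) powr q) \<in> borel_measurable \<nu>"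
    by (intro simple_funs_borel_measurable simple_funs_compose[OF f, of "\<lambda>x. norm x powr q"]) auto
  \<comment> \<open>The integrand of \<open>B t\<close> is the norm of the kernel applied to the
    simple function |f|^(q-1) f, which is Bochner integrable for almost every
    \<open>t\<close>.\<close>
  have fin: "AE t in \<mu>. B t < \<infinity>"
  proof -
    have "(\<lambda>s. (norm (f s) powr (q - 1)) *\<^sub>R f s) \<in> simple_funs \<nu>"
      by (rule simple_funs_compose[OF f, of "\<lambda>x. (norm x powr (q - 1)) *\<^sub>R x"]) simp
    from K0_simple(1)[OF this] show ?thesis
    proof eventually_elim
      case (elim t)
      show ?case using has_vector_bochner_integral_finite[OF elim] by (simp add: B_def blinfun.scaleR_right)
    qed
  qed
  have step: "AE t in \<mu>. norm (K0 f t) \<le> (1 - \<theta> / p) * \<sigma> powr (\<theta> / p) * A + \<theta> / p * \<sigma> powr (\<theta> / p - 1) * enn2real (B t)"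
    if \<sigma>: "\<sigma> > 0" for \<sigma>
  proof -
    obtain \<delta> :: "real \<Rightarrow> real" where \<delta>: "\<And>u. 0 \<le> \<delta> u" "\<And>u. \<delta> u \<le> 1"
      and \<delta>_eq: "\<And>u. u > 0 \<Longrightarrow> (1 - \<theta> / p) * \<sigma> powr (\<theta> / p) * (\<delta> u * u powr (q * (1 - 1 / \<theta>) - 1))
        + \<theta> / p * \<sigma> powr (\<theta> / p - 1) * (\<delta> u * u powr (q - 1)) = 1"
      using interpolation_weight_exists[OF \<sigma> \<theta> p q pq] by blast
    define a b where "a = (1 - \<theta> / p) * \<sigma> powr (\<theta> / p)" and "b = \<theta> / p * \<sigma> powr (\<theta> / p - 1)"
    have ab: "a \<ge> 0" "b \<ge> 0" using l \<theta> p by (auto simp: a_def b_def)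
    define g where "g s = (\<delta> (norm (f s)) * norm (f s) powr (q * (1 - 1 / \<theta>) - 1)) *\<^sub>R f s" for s
    define h where "h s = (\<delta> (norm (f s)) * norm (f s) powr (q - 1)) *\<^sub>R f s" for s
    have g: "g \<in> simple_funs \<nu>" unfolding g_def
      by (rule simple_funs_compose[OF f, of "\<lambda>x. (\<delta> (norm x) * norm x powr (q * (1 - 1 / \<theta>) - 1)) *\<^sub>R x"]) simp
    have h: "h \<in> simple_funs \<nu>" unfolding h_def
      by (rule simple_funs_compose[OF f, of "\<lambda>x. (\<delta> (norm x) * norm x powr (q - 1)) *\<^sub>R x"]) simp
    have f_eq: "f s = a *\<^sub>R g s + b *\<^sub>R h s" for s
    proof (cases "f s = 0")
      case False
      have "a *\<^sub>R g s + b *\<^sub>R h s = (a * (\<delta> (norm (f s)) * norm (f s) powr (q * (1 - 1 / \<theta>) - 1))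
          + b * (\<delta> (norm (f s)) * norm (f s) powr (q - 1))) *\<^sub>R f s"
        by (simp add: g_def h_def scaleR_add_left)
      also have "\<dots> = f s" using \<delta>_eq[of "norm (f s)"] False by (simp add: a_def b_def)
      finally show ?thesis by simp
    qed (simp add: g_def h_def)
    \<comment> \<open>The hypothesis of \<open>K0_sup_bound\<close> with w = |f|^q; the factor
      \<open>f s\<close> supplies the 1 missing in the exponent.\<close>
    have g_le: "norm (g s) \<le> (norm (f s) powr q) powr (1 - 1 / \<theta>)" for s
    proof (cases "f s = 0")
      case False
      have "norm (g s) = \<delta> (norm (f s)) * (norm (f s) powr (q * (1 - 1 / \<theta>) - 1) * norm (f s) powr 1)"
        using False \<delta> by (simp add: g_def)
      also have "\<dots> = \<delta> (norm (f s)) * (norm (f s) powr q) powr (1 - 1 / \<theta>)"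
        by (simp only: powr_add[symmetric] powr_powr) simp
      also have "\<dots> \<le> 1 * (norm (f s) powr q) powr (1 - 1 / \<theta>)" using \<delta> by (intro mult_right_mono) auto
      finally show ?thesis by simp
    qed (simp add: g_def)
    have "AE t in \<mu>. norm (K0 g t) \<le> A"
      unfolding A_def by (rule K0_sup_bound[OF g wm _ _ \<beta> g_le]) (simp_all add: int)
    then show ?thesis using K0_simple(1)[OF g] K0_simple(1)[OF h] fin
    proof eventually_elim
      case (elim t)
      have "has_vector_bochner_integral \<nu> (\<lambda>s. a *\<^sub>R blinfun_apply (k t s) (g s) + b *\<^sub>R blinfun_apply (k t s) (h s))
        (a *\<^sub>R K0 g t + b *\<^sub>R K0 h t)"
        by (intro has_vector_bochner_integral_add
            has_vector_bochner_integral_bounded_linear[OF bounded_linear_scaleR_right] elim)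
      also have "(\<lambda>s. a *\<^sub>R blinfun_apply (k t s) (g s) + b *\<^sub>R blinfun_apply (k t s) (h s))
          = (\<lambda>s. blinfun_apply (k t s) (f s))"
        by (subst f_eq) (simp add: blinfun.add_right blinfun.scaleR_right)
      finally have "K0 f t = a *\<^sub>R K0 g t + b *\<^sub>R K0 h t" by (rule K0_eq)
      moreover have "norm (K0 h t) \<le> enn2real (B t)"
      proof -
        have "ennreal (norm (K0 h t)) \<le> (\<integral>\<^sup>+ s. ennreal (norm (blinfun_apply (k t s) (h s))) \<partial>\<nu>)"
          by (rule has_vector_bochner_integral_norm_le[OF elim(3)])
        also have "\<dots> \<le> B t"
          unfolding B_def
        proof (intro nn_integral_mono ennreal_leI)
          fix s
          have "norm (blinfun_apply (k t s) (h s)) = \<delta> (norm (f s)) * (norm (f s) powr (q - 1) * norm (blinfun_apply (k t s) (f s)))"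
            using \<delta> by (simp add: h_def blinfun.scaleR_right)
          also have "\<dots> \<le> 1 * (norm (f s) powr (q - 1) * norm (blinfun_apply (k t s) (f s)))"
            using \<delta> by (intro mult_right_mono) auto
          finally show "norm (blinfun_apply (k t s) (h s)) \<le> norm (f s) powr (q - 1) * norm (blinfun_apply (k t s) (f s))"
            by simp
        qed
        finally show ?thesis using elim(4) by (cases "B t") auto
      qed
      ultimately have "norm (K0 f t) \<le> a * A + b * enn2real (B t)"
        using ab elim(1) norm_triangle_ineq[of "a *\<^sub>R K0 g t" "b *\<^sub>R K0 h t"]
          mult_left_mono[of "norm (K0 g t)" A a] mult_left_mono[of "norm (K0 h t)" "enn2real (B t)" b] by simp
      then show ?case by (simp add: a_def b_def)
    qed
  qed
  have "AE t in \<mu>. \<forall>\<sigma>\<in>{\<sigma>\<in>\<rat>. \<sigma> > 0}. norm (K0 f t) \<le> (1 - \<theta> / p) * \<sigma> powr (\<theta> / p) * A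
      + \<theta> / p * \<sigma> powr (\<theta> / p - 1) * enn2real (B t)"
    using countable_rat by (intro AE_ball_countable[THEN iffD2] ballI step) (auto intro: countable_subset)
  then show ?thesis using fin
  proof eventually_elim
    case (elim t)
    have "norm (K0 f t) \<le> real_pow A (1 - \<theta> / p) * enn2real (B t) powr (\<theta> / p)"
      using elim(1) by (intro le_interpolation_if_le_all_rational[OF l A]) auto
    then show ?case using elim(2) by (simp add: A_def)
  qed
qed

text \<open>Condition (B) gives joint measurability for a fixed vector only. As \<open>f\<close> has
  finitely many values, the function is a finite sum of such pieces, each cut to a level set of
  \<open>f\<close>.\<close>

lemma kernel_power_measurable:
  assumes f: "f \<in> simple_funs \<nu>"
  shows "(\<lambda>(t, s). norm (blinfun_apply (k t s) (f s)) powr \<theta> * norm (f s) powr r) \<in> borel_measurable (\<mu> \<Otimes>\<^sub>M \<nu>)"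
proof -
  have fm[measurable]: "f \<in> measurable \<nu> (count_space UNIV)"
    using f by (intro measurable_simple_function) (simp add: simple_funs_iff simple_bochner_integrable.simps)
  have km: "(\<lambda>z. norm (blinfun_apply (k (fst z) (snd z)) x) powr \<theta>) \<in> borel_measurable (\<mu> \<Otimes>\<^sub>M \<nu>)" for x
    using condB unfolding kernel_cond_B_def by (simp add: case_prod_unfold)
  have "(\<lambda>z. \<Sum>x\<in>range f. indicator {s\<in>space \<nu>. f s = x} (snd z) *
      (norm (blinfun_apply (k (fst z) (snd z)) x) powr \<theta> * norm x powr r)) \<in> borel_measurable (\<mu> \<Otimes>\<^sub>M \<nu>)"
    by (intro borel_measurable_sum borel_measurable_times km borel_measurable_const
        measurable_compose[OF measurable_snd borel_measurable_indicator]) measurable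
  also have "?this \<longleftrightarrow> (\<lambda>(t, s). norm (blinfun_apply (k t s) (f s)) powr \<theta> * norm (f s) powr r) \<in> borel_measurable (\<mu> \<Otimes>\<^sub>M \<nu>)"
  proof (intro measurable_cong)
    fix z assume z: "z \<in> space (\<mu> \<Otimes>\<^sub>M \<nu>)"
    obtain t s where ts: "z = (t, s)" by (cases z)
    have s: "s \<in> space \<nu>" using z ts by (auto simp: space_pair_measure)
    have "(\<Sum>x\<in>range f. indicator {s\<in>space \<nu>. f s = x} s * (norm (blinfun_apply (k t s) x) powr \<theta> * norm x powr r))
        = (\<Sum>x\<in>range f. if x = f s then norm (blinfun_apply (k t s) (f s)) powr \<theta> * norm (f s) powr r else 0)"
      using s by (intro sum.cong) (auto simp: indicator_def)
    also have "\<dots> = norm (blinfun_apply (k t s) (f s)) powr \<theta> * norm (f s) powr r"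
      using simple_funs_finite_range[OF f] by simp
    finally show "(\<Sum>x\<in>range f. indicator {s\<in>space \<nu>. f s = x} (snd z) *
      (norm (blinfun_apply (k (fst z) (snd z)) x) powr \<theta> * norm x powr r)) =
      (case z of (t, s) \<Rightarrow> norm (blinfun_apply (k t s) (f s)) powr \<theta> * norm (f s) powr r)"
      by (simp add: ts)
  qed
  finally show ?thesis .
qed

text \<open>The exceptional set in (B) depends on the vector, but only the finitely many values of
  \<open>f\<close> occur.\<close>

lemma kernel_power_integral_le:
  assumes f: "f \<in> simple_funs \<nu>"
  shows "AE s in \<nu>. (\<integral>\<^sup>+ t. ennreal (norm (blinfun_apply (k t s) (f s)) powr \<theta>) \<partial>\<mu>)
    \<le> ennreal (C1 powr \<theta> * norm (f s) powr \<theta>)"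
proof -
  have "AE s in \<nu>. (\<integral>\<^sup>+ t. ennreal (norm (blinfun_apply (k t s) x) powr \<theta>) \<partial>\<mu>) \<le> ennreal (C1 powr \<theta> * norm x powr \<theta>)" for x
  proof -
    obtain S' where S': "S' \<in> full_sets \<nu>" and le: "\<And>s. s \<in> S' \<Longrightarrow>
        ennreal_powr (\<integral>\<^sup>+ t. ennreal (norm (blinfun_apply (k t s) x) powr \<theta>) \<partial>\<mu>) (1 / \<theta>) \<le> ennreal (C1 * norm x)"
      using condB unfolding kernel_cond_B_def by blast
    show ?thesis using AE_full_sets[OF S']
    proof eventually_elim
      case (elim s)
      show ?case using le[OF elim] \<theta> C1 by (simp add: ennreal_powr_le_iff powr_mult)
    qed
  qed
  then have "AE s in \<nu>. \<forall>x\<in>range f. (\<integral>\<^sup>+ t. ennreal (norm (blinfun_apply (k t s) x) powr \<theta>) \<partial>\<mu>)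
      \<le> ennreal (C1 powr \<theta> * norm x powr \<theta>)"
    by (intro AE_finite_allI simple_funs_finite_range[OF f])
  then show ?thesis by eventually_elim blast
qed

text \<open>The p-th power of the pointwise bound contains B(t)^\<theta>. Hoelder bounds this by
  \<beta>^(\<theta>-1) times the integral of \<open>G\<close> over \<open>s\<close>, and Tonelli
  together with (B) then integrates \<open>G\<close> over \<open>t\<close>; \<open>c\<close>
  collects the constant factors.\<close>

lemma K0_power_integral_le:
  assumes f: "f \<in> simple_funs \<nu>" and \<beta>: "\<beta> > 0"
    and int: "(\<integral>\<^sup>+ s. ennreal (norm (f s) powr q) \<partial>\<nu>) = ennreal \<beta>"
  defines "c \<equiv> real_pow (\<tau> * (\<beta> powr (1 - 1 / \<theta>) * C2)) (1 - \<theta> / p) powr p * \<beta> powr (\<theta> - 1)"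
  shows "(\<integral>\<^sup>+ t. ennreal (norm (K0 f t) powr p) \<partial>\<mu>) \<le> ennreal (c * C1 powr \<theta> * \<beta>)"
proof -
  \<comment> \<open>The exponent \<open>q - \<theta>\<close> may be negative; where \<open>f\<close>
    vanishes, \<open>powr\<close> still returns 0.\<close>
  define G where "G z = norm (blinfun_apply (k (fst z) (snd z)) (f (snd z))) powr \<theta> * norm (f (snd z)) powr (q - \<theta>)" for z
  have Gm[measurable]: "G \<in> borel_measurable (\<mu> \<Otimes>\<^sub>M \<nu>)"
    using kernel_power_measurable[OF f, of "q - \<theta>"] by (simp add: G_def[abs_def] case_prod_unfold)
  have G0: "G z \<ge> 0" for z by (simp add: G_def)
  have c0: "c \<ge> 0" by (simp add: c_def)
  define S where "S = {s\<in>space \<nu>. f s \<noteq> 0}"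
  have S: "S \<in> finite_sets \<nu>" unfolding S_def by (rule simple_funs_support[OF f])
  have wm: "(\<lambda>s. norm (f s) powr q) \<in> borel_measurable \<nu>"
    by (intro simple_funs_borel_measurable simple_funs_compose[OF f, of "\<lambda>x. norm x powr q"]) auto
  obtain E :: "nat \<Rightarrow> 't set" where E: "\<And>n. E n \<in> finite_sets \<mu>" "AE t in \<mu>. K0 f t \<noteq> 0 \<longrightarrow> t \<in> (\<Union>n. E n)"
    using strongly_measurable_sigma_finite_support[OF K0_simple(2)[OF f]] by blast
  have "AE t in \<mu>. ennreal (norm (K0 f t) powr p)
      \<le> indicator (\<Union>n. E n) t * (\<integral>\<^sup>+ s. indicator S s * ennreal (c * G (t, s)) \<partial>\<nu>)"
    using K0_pointwise_bound[OF f \<beta> int] E(2) AE_space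
  proof eventually_elim
    case (elim t)
    show ?case
    proof (cases "K0 f t = 0")
      case False
      define B where "B = (\<integral>\<^sup>+ s. ennreal (norm (f s) powr (q - 1) * norm (blinfun_apply (k t s) (f s))) \<partial>\<nu>)"
      define R where "R = real_pow (\<tau> * (\<beta> powr (1 - 1 / \<theta>) * C2)) (1 - \<theta> / p)"
      have R0: "R \<ge> 0" by (simp add: R_def real_pow_def)
      have Bfin: "B < \<infinity>" and Kle: "norm (K0 f t) \<le> R * enn2real B powr (\<theta> / p)"
        using elim(1) by (simp_all add: B_def R_def)
      have Gt: "(\<lambda>s. G (t, s)) \<in> borel_measurable \<nu>" by (rule measurable_Pair2[OF Gm elim(3)])
      define e where "e = (\<integral>\<^sup>+ s. ennreal (G (t, s)) \<partial>\<nu>)"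
      have Be: "ennreal (enn2real B powr \<theta>) \<le> ennreal (\<beta> powr (\<theta> - 1)) * e"
      \<comment> \<open>If \<open>e\<close> is infinite the bound is trivial, since \<beta> >
        0.\<close>
      proof (cases e)
        case (real r)
        \<comment> \<open>The Hoelder split: the exponents of |f| add up to q (1 - 1/\<theta>) + (q
          - \<theta>) / \<theta> = q - 1.\<close>
        have "B = (\<integral>\<^sup>+ s. ennreal ((norm (f s) powr q) powr (1 - 1 / \<theta>) * G (t, s) powr (1 / \<theta>)) \<partial>\<nu>)"
          unfolding B_def
        proof (intro nn_integral_cong arg_cong[of _ _ ennreal])
          fix s
          show "norm (f s) powr (q - 1) * norm (blinfun_apply (k t s) (f s)) =
              (norm (f s) powr q) powr (1 - 1 / \<theta>) * G (t, s) powr (1 / \<theta>)"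
          proof (cases "f s = 0")
            case False
            have "(norm (f s) powr q) powr (1 - 1 / \<theta>) * G (t, s) powr (1 / \<theta>) =
              norm (f s) powr (q * (1 - 1 / \<theta>) + (q - \<theta>) * (1 / \<theta>)) * norm (blinfun_apply (k t s) (f s))"
              using \<theta> by (simp add: G_def powr_mult powr_powr powr_add)
            also have "q * (1 - 1 / \<theta>) + (q - \<theta>) * (1 / \<theta>) = q - 1" using \<theta> by (simp add: field_simps)
            finally show ?thesis by simp
          qed (simp add: G_def)
        qed
        also have "\<dots> \<le> ennreal (\<beta> powr (1 - 1 / \<theta>) * r powr (1 / \<theta>))"
          using \<theta> wm Gt \<beta> real int G0 by (intro nn_integral_powr_interpolation) (auto simp: e_def[symmetric])
        finally have "enn2real B \<le> \<beta> powr (1 - 1 / \<theta>) * r powr (1 / \<theta>)"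
          using Bfin by (cases B) auto
        then have "enn2real B powr \<theta> \<le> (\<beta> powr (1 - 1 / \<theta>) * r powr (1 / \<theta>)) powr \<theta>"
          using \<theta> by (intro powr_mono2) auto
        also have "\<dots> = \<beta> powr ((1 - 1 / \<theta>) * \<theta>) * r"
          using \<theta> real by (simp add: powr_mult powr_powr)
        also have "(1 - 1 / \<theta>) * \<theta> = \<theta> - 1" using \<theta> by (simp add: field_simps)
        finally show ?thesis using real by (simp flip: ennreal_mult)
      qed (use \<beta> in \<open>simp add: ennreal_mult_top\<close>)
      have "norm (K0 f t) powr p \<le> (R * enn2real B powr (\<theta> / p)) powr p"
        using Kle \<theta> p by (intro powr_mono2) auto
      also have "\<dots> = R powr p * enn2real B powr \<theta>"
        using R0 \<theta> p by (simp add: powr_mult powr_powr)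
      finally have "ennreal (norm (K0 f t) powr p) \<le> ennreal (R powr p) * ennreal (enn2real B powr \<theta>)"
        by (simp flip: ennreal_mult)
      also have "\<dots> \<le> ennreal (R powr p) * (ennreal (\<beta> powr (\<theta> - 1)) * e)"
        by (intro mult_left_mono Be) auto
      also have "\<dots> = ennreal c * e" by (simp add: c_def R_def ennreal_mult mult.assoc)
      also have "\<dots> = (\<integral>\<^sup>+ s. ennreal c * ennreal (G (t, s)) \<partial>\<nu>)"
        unfolding e_def using Gt by (intro nn_integral_cmult[symmetric]) auto
      \<comment> \<open>\<open>G\<close> vanishes off the support \<open>S\<close> of
        \<open>f\<close>, so the restriction to a set of finite measure that Tonelli asks for is
        free.\<close>
      also have "\<dots> = (\<integral>\<^sup>+ s. indicator S s * ennreal (c * G (t, s)) \<partial>\<nu>)"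
        using c0 G0 by (intro nn_integral_cong) (auto simp: indicator_def S_def G_def ennreal_mult)
      finally show ?thesis using elim(2) False by simp
    qed simp
  qed
  then have "(\<integral>\<^sup>+ t. ennreal (norm (K0 f t) powr p) \<partial>\<mu>)
      \<le> (\<integral>\<^sup>+ t. indicator (\<Union>n. E n) t * (\<integral>\<^sup>+ s. indicator S s * ennreal (c * G (t, s)) \<partial>\<nu>) \<partial>\<mu>)"
    by (rule nn_integral_mono_AE)
  also have "\<dots> \<le> (\<integral>\<^sup>+ s. ennreal (c * C1 powr \<theta>) * ennreal (norm (f s) powr q) \<partial>\<nu>)"
  proof (rule nn_integral_Tonelli_le[OF _ E(1) S])
    show "AE s in \<nu>. (\<integral>\<^sup>+ t. ennreal (c * G (t, s)) \<partial>\<mu>) \<le> ennreal (c * C1 powr \<theta>) * ennreal (norm (f s) powr q)"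
      using kernel_power_integral_le[OF f] AE_space
    proof eventually_elim
      case (elim s)
      have km: "(\<lambda>t. norm (blinfun_apply (k t s) x) powr \<theta>) \<in> borel_measurable \<mu>" for x
      proof -
        have "(\<lambda>(t, s). norm (blinfun_apply (k t s) x) powr \<theta>) \<in> borel_measurable (\<mu> \<Otimes>\<^sub>M \<nu>)"
          using condB unfolding kernel_cond_B_def by blast
        from measurable_Pair1[OF this elim(2)] show ?thesis by simp
      qed
      have "(\<integral>\<^sup>+ t. ennreal (c * G (t, s)) \<partial>\<mu>) =
          (\<integral>\<^sup>+ t. ennreal (c * norm (f s) powr (q - \<theta>)) * ennreal (norm (blinfun_apply (k t s) (f s)) powr \<theta>) \<partial>\<mu>)"
        using c0 by (intro nn_integral_cong) (simp add: G_def mult_ac flip: ennreal_mult)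
      also have "\<dots> = ennreal (c * norm (f s) powr (q - \<theta>)) * (\<integral>\<^sup>+ t. ennreal (norm (blinfun_apply (k t s) (f s)) powr \<theta>) \<partial>\<mu>)"
        using km by (intro nn_integral_cmult) auto
      also have "\<dots> \<le> ennreal (c * norm (f s) powr (q - \<theta>)) * ennreal (C1 powr \<theta> * norm (f s) powr \<theta>)"
        by (intro mult_left_mono elim) auto
      also have "\<dots> = ennreal (c * C1 powr \<theta> * (norm (f s) powr (q - \<theta>) * norm (f s) powr \<theta>))"
        using c0 by (simp add: mult_ac flip: ennreal_mult)
      also have "norm (f s) powr (q - \<theta>) * norm (f s) powr \<theta> = norm (f s) powr q"
        by (simp flip: powr_add)
      finally show ?case using c0 by (simp add: ennreal_mult)
    qed
  qed measurable
  also have "\<dots> = ennreal (c * C1 powr \<theta>) * ennreal \<beta>"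
    using wm by (subst nn_integral_cmult) (auto simp: int)
  also have "\<dots> = ennreal (c * C1 powr \<theta> * \<beta>)" using c0 \<beta> by (simp add: ennreal_mult)
  finally show ?thesis .
qed

text \<open>Bookkeeping of exponents: with \<beta> the q-th power of the norm of \<open>f\<close>,
  all powers of \<beta> combine to p / q, that is, to the p-th power of the norm. Norm 0 is treated
  apart because \<beta> has to be positive.\<close>

lemma K0_Lp_bound:
  assumes f: "f \<in> simple_funs \<nu>"
  shows "Lp_norm \<mu> p (K0 f) \<le>
    ennreal (real_pow C1 (\<theta> / p) * real_pow (\<tau> * C2) (1 - \<theta> / p)) * Lp_norm \<nu> q f"
proof -
  have p1: "p > 0" "p \<ge> 1" using p \<theta> by auto
  have "Lp_norm \<nu> q f < \<infinity>" using simple_funs_Lp[OF _ f, of q] q by (simp add: Lp_funs_def)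
  then obtain b where b: "b \<ge> 0" "Lp_norm \<nu> q f = ennreal b" by (rule Lp_norm_finiteE)
  show ?thesis
  proof (cases "b = 0")
    case True
    then have "AE s in \<nu>. f s = 0"
      using b q by (intro Lp_norm_eq_0_AE[of q] strongly_measurable_simple f) auto
    then have z: "(\<integral>\<^sup>+ s. ennreal (norm (blinfun_apply (k t s) (f s))) \<partial>\<nu>) = (\<integral>\<^sup>+ s. 0 \<partial>\<nu>)" for t
      by (intro nn_integral_cong_AE) (auto elim!: eventually_mono)
    have "AE t in \<mu>. norm (K0 f t) = norm (0 :: 'y)"
      using K0_simple(1)[OF f]
    proof eventually_elim
      case (elim t)
      show ?case using has_vector_bochner_integral_norm_le[OF elim] unfolding z by simp
    qed
    then have "Lp_norm \<mu> p (K0 f) = Lp_norm \<mu> p (\<lambda>t. 0 :: 'y)" by (rule Lp_norm_cong_AE)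
    then show ?thesis using p1 by (simp add: Lp_norm_zero)
  next
    case False
    define \<beta> where "\<beta> = b powr q"
    have \<beta>: "\<beta> > 0" using False b by (simp add: \<beta>_def)
    have b_eq: "b = \<beta> powr (1 / q)" using b q by (simp add: \<beta>_def powr_powr)
    have int: "(\<integral>\<^sup>+ s. ennreal (norm (f s) powr q) \<partial>\<nu>) = ennreal \<beta>"
    proof (cases "\<integral>\<^sup>+ s. ennreal (norm (f s) powr q) \<partial>\<nu>")
      case (real r)
      then have "r powr (1 / q) = b" using b by (simp add: Lp_norm_def ennreal_powr_def)
      then show ?thesis using real q by (simp add: \<beta>_def powr_powr flip: \<open>r powr (1 / q) = b\<close>)
    qed (use b in \<open>simp add: Lp_norm_def ennreal_powr_def\<close>)
    define R where "R = real_pow (\<tau> * C2) (1 - \<theta> / p)"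
    have R0: "R \<ge> 0" by (simp add: R_def real_pow_def)
    have RA: "real_pow (\<tau> * (\<beta> powr (1 - 1 / \<theta>) * C2)) (1 - \<theta> / p) = R * \<beta> powr ((1 - 1 / \<theta>) * (1 - \<theta> / p))"
      using \<beta> \<tau> C2 by (simp add: R_def real_pow_def powr_mult powr_powr)
    have "(R * \<beta> powr ((1 - 1 / \<theta>) * (1 - \<theta> / p))) powr p * \<beta> powr (\<theta> - 1) * C1 powr \<theta> * \<beta>
        = C1 powr \<theta> * R powr p * (\<beta> powr ((1 - 1 / \<theta>) * (1 - \<theta> / p) * p) * \<beta> powr (\<theta> - 1) * \<beta> powr 1)"
      using R0 \<beta> by (simp add: powr_mult powr_powr)
    also have "\<beta> powr ((1 - 1 / \<theta>) * (1 - \<theta> / p) * p) * \<beta> powr (\<theta> - 1) * \<beta> powr 1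
        = \<beta> powr ((1 - 1 / \<theta>) * (1 - \<theta> / p) * p + (\<theta> - 1) + 1)"
      by (simp only: powr_add)
    also have "(1 - 1 / \<theta>) * (1 - \<theta> / p) * p + (\<theta> - 1) + 1 = 1 / q * p"
    proof -
      have "1 / q = 1 / p + (1 - 1 / \<theta>)" using pq by simp
      then have "1 / q * p = 1 / p * p + (1 - 1 / \<theta>) * p" by (simp only: distrib_right)
      then have "1 / q * p = 1 + (1 - 1 / \<theta>) * p" using p1 by simp
      moreover have "(1 - 1 / \<theta>) * (1 - \<theta> / p) * p = (1 - 1 / \<theta>) * p - (1 - 1 / \<theta>) * \<theta>"
      proof -
        have "(1 - \<theta> / p) * p = p - \<theta>" using p1 by (simp add: left_diff_distrib)
        then show ?thesis unfolding mult.assoc by (simp add: right_diff_distrib)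
      qed
      moreover have "(1 - 1 / \<theta>) * \<theta> = \<theta> - 1" using \<theta> by (simp add: left_diff_distrib)
      ultimately show ?thesis by linarith
    qed
    also have "C1 powr \<theta> * R powr p * \<beta> powr (1 / q * p) = (C1 powr (\<theta> / p) * R * b) powr p"
      using R0 p1 b C1 by (simp add: b_eq powr_mult powr_powr)
    \<comment> \<open>The exponent \<theta> / p is nonzero, so \<open>powr\<close> and
      \<open>real_pow\<close> agree here; 1 - \<theta> / p may be 0, hence \<open>R\<close> is
      defined by \<open>real_pow\<close>.\<close>
    also have "C1 powr (\<theta> / p) * R * b = real_pow C1 (\<theta> / p) * R * b"
      using \<theta> p1 by (simp add: real_pow_def)
    finally have "(\<integral>\<^sup>+ t. ennreal (norm (K0 f t) powr p) \<partial>\<mu>) \<le> ennreal ((real_pow C1 (\<theta> / p) * R * b) powr p)"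
      using K0_power_integral_le[OF f \<beta> int] unfolding RA by simp
    then have "Lp_norm \<mu> p (K0 f) \<le> ennreal (real_pow C1 (\<theta> / p) * R * b)"
      using p1 R0 b by (subst Lp_norm_le_iff) (auto simp: real_pow_def)
    also have "\<dots> = ennreal (real_pow C1 (\<theta> / p) * R) * Lp_norm \<nu> q f"
      using b R0 by (simp add: ennreal_mult real_pow_def)
    finally show ?thesis by (simp add: R_def)
  qed
qed

end

section \<open>Admissible exponents and assembly of the extension\<close>

theorem theorem2p7:
  fixes \<mu> :: "'t measure" and \<nu> :: "'s measure"
    and k :: "'t \<Rightarrow> 's \<Rightarrow> 'x :: complex_banach \<Rightarrow>\<^sub>L 'y :: complex_banach"
    and Z :: "('y \<Rightarrow>\<^sub>L complex) set"
    and \<tau> \<theta> p q C1 C2 :: real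
  assumes "Z \<subseteq> cdual" and "csubspace Z" and "\<tau> \<ge> 1" and "norms_space \<tau> Z"
    and "\<theta> \<ge> 1" and "1 / q - 1 / p = 1 - 1 / \<theta>"
    and "q \<ge> 1" and "ereal q < (if \<theta> = 1 then \<infinity> else ereal (\<theta> / (\<theta> - 1)))"
    and "\<And>t s. t \<in> space \<mu> \<Longrightarrow> s \<in> space \<nu> \<Longrightarrow> k t s \<in> bounded_clinear_ops"
    and "C1 \<ge> 0" and "C2 \<ge> 0"
    and "kernel_cond_A \<mu> \<nu> k"
    and "kernel_cond_B \<mu> \<nu> \<theta> C1 k"
    and "kernel_cond_C \<mu> \<nu> \<theta> C2 Z k"
  shows "\<exists>K :: ('s \<Rightarrow> 'x) \<Rightarrow> ('t \<Rightarrow> 'y).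
      bounded_Lp_operator \<nu> q \<mu> p K \<and>
      (\<forall>f\<in>simple_funs \<nu>. AE t in \<mu>.
         has_vector_bochner_integral \<nu> (\<lambda>s. blinfun_apply (k t s) (f s)) (K f t)) \<and>
      Lp_operator_norm \<nu> q \<mu> p K
        \<le> ennreal (real_pow C1 (\<theta> / p) * real_pow (\<tau> * C2) (1 - \<theta> / p))"
proof -
  \<comment> \<open>The strict upper bound on \<open>q\<close> amounts to 1 / p > 0, which also
    excludes \<open>p = 0\<close>, where 1 / p would be 0; the lower bound \<open>q \<ge> 1\<close>
    then yields \<open>p \<ge> \<theta>\<close>.\<close>
  have "1 / q > 1 - 1 / \<theta>"
  proof (cases "\<theta> = 1")
    case False
    with assms(5,7,8) have "q < \<theta> / (\<theta> - 1)" "\<theta> > 1" by auto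
    then have "1 / (\<theta> / (\<theta> - 1)) < 1 / q" using assms(7) by (intro divide_strict_left_mono) auto
    then show ?thesis using \<open>\<theta> > 1\<close> by (simp add: diff_divide_distrib)
  qed (use assms(7) in simp)
  then have "1 / p > 0" using assms(6) by linarith
  then have p0: "p > 0" by simp
  have "1 / q \<le> 1" using assms(7) by simp
  then have "1 / p \<le> 1 / \<theta>" using assms(6) by linarith
  then have p: "p \<ge> \<theta>" using p0 assms(5) by (simp add: field_simps)
  interpret operator_kernel \<mu> \<nu> k Z \<tau> \<theta> p q C1 C2
    by unfold_locales (use assms p in auto)
  interpret Lp_bounded_on_simple \<nu> \<mu> p q "real_pow C1 (\<theta> / p) * real_pow (\<tau> * C2) (1 - \<theta> / p)" K0
    by unfold_locales
      (use assms(5,7) p K0_simple(2) K0_add K0_scaleC K0_Lp_bound in \<open>auto simp: real_pow_def\<close>)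
  obtain K where K: "bounded_Lp_operator \<nu> q \<mu> p K" "\<And>f. f \<in> simple_funs \<nu> \<Longrightarrow> AE t in \<mu>. K f t = K0 f t"
    "Lp_operator_norm \<nu> q \<mu> p K \<le> ennreal (real_pow C1 (\<theta> / p) * real_pow (\<tau> * C2) (1 - \<theta> / p))"
    using extension by blast
  have "AE t in \<mu>. has_vector_bochner_integral \<nu> (\<lambda>s. blinfun_apply (k t s) (f s)) (K f t)"
    if "f \<in> simple_funs \<nu>" for f
    using K(2)[OF that] K0_simple(1)[OF that] by eventually_elim simp
  with K show ?thesis by blast
qed

end
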